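(* Let $m$ be a nonnegative integer and $\beta,\delta\in\mathbb R$. If $s>\frac32+m$ and $\delta+\frac32\ge\beta$, then any $u\in H_{s,\delta}$ has a representative $\tilde u\in C^m_\beta$ satisfying $$\|\tilde u\|_{C^m_\beta}\le C\|u\|_{H_{s,\delta}},$$ with a constant $C$ independent of $u$.
   Context: $\|u\|_{C^m_\beta}=\sum_{|\alpha|\le m}\sup_{x\in\mathbb R^3}\bigl((1+|x|)^{\beta+|\alpha|}|\partial^\alpha u(x)|\bigr)$ and $C^m_\beta$ is the corresponding space of functions on $\mathbb R^3$. Weighted spaces: let $K_0=\{x\in\mathbb R^3:|x|\le4\}$, $K_j=\{2^{j-3}\le|x|\le2^{j+2}\}$ for $j\ge1$. Fix $\psi_j\in C_0^\infty(\mathbb R^3)$ with $\psi_j=1$ on $K_j$, $\operatorname{supp}\psi_j\subset\{2^{j-4}\le|x|\le2^{j+3}\}$ for $j\ge1$, $\operatorname{supp}\psi_0\subset\{|x|\le8\}$, and $|\partial^\beta\psi_j|\le C_\beta2^{-|\beta|j}$ (for all multi-indices $\beta$) with $C_\beta$ independent of $j$. Write $f_\varepsilon(x)=f(\varepsilon x)$ and let $H^s$ be the Bessel potential space, $\|u\|_{H^s}^2=\int(1+|\xi|^2)^s|\hat u|^2d\xi$. For $s\ge0,\delta\in\mathbb R$, $H_{s,\delta}$ is the space of tempered distributions on $\mathbb R^3$ with finite norm $\|u\|_{H_{s,\delta}}^2=\sum_{j\ge0}2^{(\frac32+\delta)2j}\|(\psi_ju)_{2^j}\|_{H^s}^2$.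 *)

theory Defs
  imports "HOL-Analysis.Analysis"
begin

section \<open>Differentiation of functions on three-dimensional space\<close>

definition partial :: "3 \<Rightarrow> (real^3 \<Rightarrow> complex) \<Rightarrow> real^3 \<Rightarrow> complex"
  where "partial i f x = frechet_derivative f (at x) (axis i 1)"

type_synonym multi_index = "nat^3"

definition order_mi :: "multi_index \<Rightarrow> nat"
  where "order_mi \<alpha> = (\<Sum>i\<in>UNIV. \<alpha> $ i)"

definition mderiv :: "multi_index \<Rightarrow> (real^3 \<Rightarrow> complex) \<Rightarrow> real^3 \<Rightarrow> complex"
  where "mderiv \<alpha> f = (partial 1 ^^ (\<alpha> $ 1)) ((partial 2 ^^ (\<alpha> $ 2)) ((partial 3 ^^ (\<alpha> $ 3)) f))"

text \<open>Membership in $C^k$. As the partial derivatives of a $C^{k+1}$ function are continuous,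
  such a function is Frechet differentiable, and nothing is lost by asking for the latter.\<close>

fun C_k :: "nat \<Rightarrow> (real^3 \<Rightarrow> complex) \<Rightarrow> bool" where
  "C_k 0 f \<longleftrightarrow> continuous_on UNIV f"
| "C_k (Suc k) f \<longleftrightarrow> (\<forall>x. f differentiable (at x)) \<and> (\<forall>i. C_k k (partial i f))"

definition smooth :: "(real^3 \<Rightarrow> complex) \<Rightarrow> bool"
  where "smooth f \<longleftrightarrow> (\<forall>k. C_k k f)"

definition supp :: "(real^3 \<Rightarrow> complex) \<Rightarrow> (real^3) set"
  where "supp f = closure {x. f x \<noteq> 0}"

lemma finite_order_mi_le: "finite {\<alpha>. order_mi \<alpha> \<le> m}"
proof -
  have "{\<alpha>. order_mi \<alpha> \<le> m} \<subseteq> vec_lambda ` (UNIV \<rightarrow>\<^sub>E {..m})"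
  proof
    fix \<alpha> :: multi_index
    assume "\<alpha> \<in> {\<alpha>. order_mi \<alpha> \<le> m}"
    then have "\<alpha> $ i \<le> m" for i
      using member_le_sum[of i UNIV "\<lambda>i. \<alpha> $ i"] by (simp add: order_mi_def)
    then have "vec_nth \<alpha> \<in> UNIV \<rightarrow>\<^sub>E {..m}"
      by (auto simp: PiE_def Pi_def extensional_def)
    then show "\<alpha> \<in> vec_lambda ` (UNIV \<rightarrow>\<^sub>E {..m})"
      by (metis image_eqI vec_nth_inverse)
  qed
  moreover have "finite ((UNIV :: 3 set) \<rightarrow>\<^sub>E {..m})"
    by (intro finite_PiE) auto
  ultimately show ?thesis
    by (meson finite_imageI finite_subset)
qed


section \<open>The weighted spaces of continuously differentiable functions\<close>

definition C_weighted_norm :: "nat \<Rightarrow> real \<Rightarrow> (real^3 \<Rightarrow> complex) \<Rightarrow> real"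
  where "C_weighted_norm m \<beta> u =
    (\<Sum>\<alpha> | order_mi \<alpha> \<le> m.
      SUP x. (1 + norm x) powr (\<beta> + real (order_mi \<alpha>)) * norm (mderiv \<alpha> u x))"

text \<open>Finiteness of the norm is stated as boundedness, since the supremum of an unbounded set of
  reals is unspecified.\<close>

definition C_weighted :: "nat \<Rightarrow> real \<Rightarrow> (real^3 \<Rightarrow> complex) set"
  where "C_weighted m \<beta> = {u. C_k m u \<and>
    (\<forall>\<alpha>. order_mi \<alpha> \<le> m \<longrightarrow>
      bdd_above (range (\<lambda>x. (1 + norm x) powr (\<beta> + real (order_mi \<alpha>)) * norm (mderiv \<alpha> u x))))}"


section \<open>Tempered distributions\<close>

definition schwartz :: "(real^3 \<Rightarrow> complex) set"
  where "schwartz = {\<phi>. smooth \<phi> \<and>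
    (\<forall>\<alpha> N. bdd_above (range (\<lambda>x. (1 + norm x) ^ N * norm (mderiv \<alpha> \<phi> x))))}"

definition schwartz_seminorm :: "nat \<Rightarrow> (real^3 \<Rightarrow> complex) \<Rightarrow> real"
  where "schwartz_seminorm N \<phi> =
    (\<Sum>\<alpha> | order_mi \<alpha> \<le> N. SUP x. (1 + norm x) ^ N * norm (mderiv \<alpha> \<phi> x))"

text \<open>Functionals are total functions in HOL; only their values on Schwartz functions matter.
  No complex conjugation occurs in the pairing with a function.\<close>

type_synonym functional = "(real^3 \<Rightarrow> complex) \<Rightarrow> complex"

definition tempered :: "functional \<Rightarrow> bool"
  where "tempered T \<longleftrightarrow>
    (\<forall>\<phi>\<in>schwartz. \<forall>\<eta>\<in>schwartz. T (\<lambda>x. \<phi> x + \<eta> x) = T \<phi> + T \<eta>) \<and>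
    (\<forall>c. \<forall>\<phi>\<in>schwartz. T (\<lambda>x. c * \<phi> x) = c * T \<phi>) \<and>
    (\<exists>C N. \<forall>\<phi>\<in>schwartz. norm (T \<phi>) \<le> C * schwartz_seminorm N \<phi>)"

definition represents :: "(real^3 \<Rightarrow> complex) \<Rightarrow> functional \<Rightarrow> bool"
  where "represents g T \<longleftrightarrow> g \<in> borel_measurable lborel \<and>
    (\<forall>\<phi>\<in>schwartz. integrable lborel (\<lambda>x. g x * \<phi> x) \<and> T \<phi> = (LINT x|lborel. g x * \<phi> x))"

definition dist_mult :: "(real^3 \<Rightarrow> complex) \<Rightarrow> functional \<Rightarrow> functional"
  where "dist_mult \<psi> T \<phi> = T (\<lambda>x. \<psi> x * \<phi> x)"

text \<open>The distribution $T_\varepsilon(x) = T(\varepsilon x)$; the formula is the change of variables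
  $\int f(\varepsilon x)\phi(x)\,dx = \varepsilon^{-3}\int f(y)\phi(y/\varepsilon)\,dy$.\<close>

definition dist_dilate :: "real \<Rightarrow> functional \<Rightarrow> functional"
  where "dist_dilate \<epsilon> T \<phi> = T (\<lambda>y. \<phi> (y /\<^sub>R \<epsilon>)) / of_real (\<epsilon> ^ 3)"

definition fourier :: "(real^3 \<Rightarrow> complex) \<Rightarrow> real^3 \<Rightarrow> complex"
  where "fourier \<phi> \<xi> =
    of_real ((2 * pi) powr (-3/2)) * (LINT x|lborel. cis (- (x \<bullet> \<xi>)) * \<phi> x)"

definition dist_fourier :: "functional \<Rightarrow> functional"
  where "dist_fourier T \<phi> = T (fourier \<phi>)"


section \<open>Bessel potential norms and weighted Sobolev spaces\<close>

text \<open>The squared $H^s$ norm, with value $\infty$ if the Fourier transform of the distribution is not a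
  function: the infimum of the empty set is $\infty$. Otherwise the representing function is
  unique almost everywhere and the infimum is over a single value.\<close>

definition Hs_norm_sq :: "real \<Rightarrow> functional \<Rightarrow> ennreal"
  where "Hs_norm_sq s T = (INF g \<in> {g. represents g (dist_fourier T)}.
    \<integral>\<^sup>+ \<xi>. ennreal ((1 + (norm \<xi>)\<^sup>2) powr s * (norm (g \<xi>))\<^sup>2) \<partial>lborel)"

definition K :: "nat \<Rightarrow> (real^3) set"
  where "K j = (if j = 0 then {x. norm x \<le> 4}
    else {x. 2 powi (int j - 3) \<le> norm x \<and> norm x \<le> 2 powi (int j + 2)})"

definition dyadic_cutoffs :: "(nat \<Rightarrow> real^3 \<Rightarrow> complex) \<Rightarrow> bool"
  where "dyadic_cutoffs \<psi> \<longleftrightarrow>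
    (\<forall>j. smooth (\<psi> j) \<and> compact (supp (\<psi> j)) \<and> (\<forall>x\<in>K j. \<psi> j x = 1)) \<and>
    supp (\<psi> 0) \<subseteq> {x. norm x \<le> 8} \<and>
    (\<forall>j\<ge>1. supp (\<psi> j) \<subseteq> {x. 2 powi (int j - 4) \<le> norm x \<and> norm x \<le> 2 powi (int j + 3)}) \<and>
    (\<forall>\<alpha>. \<exists>C::real. \<forall>j x. norm (mderiv \<alpha> (\<psi> j) x) \<le> C * 2 powi (- int (order_mi \<alpha> * j)))"

definition H_weighted_norm_sq ::
    "(nat \<Rightarrow> real^3 \<Rightarrow> complex) \<Rightarrow> real \<Rightarrow> real \<Rightarrow> functional \<Rightarrow> ennreal"
  where "H_weighted_norm_sq \<psi> s \<delta> u =
    (\<Sum>j. ennreal (2 powr ((3/2 + \<delta>) * 2 * real j)) *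
      Hs_norm_sq s (dist_dilate (2 ^ j) (dist_mult (\<psi> j) u)))"

definition H_weighted ::
    "(nat \<Rightarrow> real^3 \<Rightarrow> complex) \<Rightarrow> real \<Rightarrow> real \<Rightarrow> functional set"
  where "H_weighted \<psi> s \<delta> = {u. tempered u \<and> H_weighted_norm_sq \<psi> s \<delta> u < \<infinity>}"

definition H_weighted_norm ::
    "(nat \<Rightarrow> real^3 \<Rightarrow> complex) \<Rightarrow> real \<Rightarrow> real \<Rightarrow> functional \<Rightarrow> real"
  where "H_weighted_norm \<psi> s \<delta> u = sqrt (enn2real (H_weighted_norm_sq \<psi> s \<delta> u))"

end

theory Submission
  imports Defs "HOL-Probability.Characteristic_Functions"
begin

text \<open>On the dyadic annulus $|x| \sim 2^j$ the distribution $u$ is the dilate of $(\psi_j u)_{2^j}$, whose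
  Fourier transform is a function $g_j$ with $\int (1+|\xi|^2)^s |g_j|^2 < \infty$. As $s > 3/2 + m$,
  Cauchy--Schwarz bounds $\int (1+|\xi|)^m |g_j|$ by the $H^s$ norm, so that the Fourier integral of
  $g_j$ is $C^m$ and represents $(\psi_j u)_{2^j}$. On the annulus, rescaling turns the weight
  $(1+|x|)^{\beta+|\alpha|}$ into a multiple of $2^{j\beta}$, which is at most $2^{j(3/2+\delta)}$.
  The local representatives agree on overlaps. They represent $u$ on every Schwartz function
  $\phi$: the functions $\psi_0(4 \cdot 2^{-N} x)\phi(x)$ tend to $\phi$, and the differences of
  consecutive ones live on a single annulus. As derivatives are taken in a fixed order
  throughout, symmetry of mixed partial derivatives is never needed.\<close>

section \<open>Calculus of iterated partial derivatives\<close>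


text \<open>The cutoffs are no partition of unity, so u is not reassembled from the pieces \<psi>_j
  u by summation. What is used is that \<psi>_j = 1 on the j-th annulus: against test functions
  supported there, the piece is u itself. The only global cutoff is a rescaled \<psi>_0. The same
  \<psi>_0 supplies, as |\<psi>_0|^2, the bump of nonzero integral whose shrunken copies test a
  continuous function at a point, which is how overlapping pieces are compared. A second obstacle is
  that the H^s norm is an infimum over the densities that represent the Fourier transform, while
  each piece is built from one chosen density. The chosen density is compared with a nearly optimal
  one through the inverse transforms, which are continuous and agree against test functions, hence
  everywhere. Fourier inversion is proved for functions by Gaussian regularisation, applied to
  smooth compactly supported ones, and carried over to distributions by the multiplication
  formula.\<close>

lemma partial_eqI: "(f has_derivative f') (at x) \<Longrightarrow> partial i f x = f' (axis i 1)"
  unfolding partial_def by (drule frechet_derivative_at) simp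

text \<open>Locally equal functions have the same set of derivatives at \<open>x\<close>, so the
  choice operator behind \<open>frechet_derivative\<close> returns the same map, even when that set
  is empty. Hence the congruence passes to iterated derivatives of arbitrary functions.\<close>

lemma partial_cong_open:
  assumes "open U" "x \<in> U" "\<And>y. y \<in> U \<Longrightarrow> f y = g y"
  shows "partial i f x = partial i g x"
proof -
  have "(f has_derivative f') (at x) = (g has_derivative f') (at x)" for f'
    using has_derivative_transform_within_open[of f f' x UNIV U g]
      has_derivative_transform_within_open[of g f' x UNIV U f] assms by auto
  then show ?thesis unfolding partial_def frechet_derivative_def by (simp only:)
qed

lemma partial_funpow_cong_open:
  assumes "open U" "\<And>y. y \<in> U \<Longrightarrow> f y = g y" "x \<in> U"
  shows "(partial i ^^ n) f x = (partial i ^^ n) g x"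
  using assms(3)
proof (induction n arbitrary: x)
  case (Suc n)
  have "partial i ((partial i ^^ n) f) x = partial i ((partial i ^^ n) g) x"
    by (rule partial_cong_open[OF assms(1) Suc.prems Suc.IH])
  then show ?case by simp
qed (use assms in simp)

lemma mderiv_cong_open:
  assumes "open U" "\<And>y. y \<in> U \<Longrightarrow> f y = g y" "x \<in> U"
  shows "mderiv \<alpha> f x = mderiv \<alpha> g x"
  unfolding mderiv_def
  by (rule partial_funpow_cong_open[OF assms(1) _ assms(3)])
    (rule partial_funpow_cong_open[OF assms(1)], rule partial_funpow_cong_open[OF assms(1,2)])

lemma C_k_Suc_imp: "C_k (Suc k) f \<Longrightarrow> C_k k f"
proof (induction k arbitrary: f)
  case 0
  then show ?case
    by (auto simp: continuous_on_eq_continuous_at differentiable_imp_continuous_within)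
next
  case (Suc k)
  from Suc.prems have "\<forall>x. f differentiable (at x)" "\<forall>i. C_k (Suc k) (partial i f)"
    unfolding C_k.simps(2)[of "Suc k" f] by blast+
  with Suc.IH show ?case unfolding C_k.simps(2)[of k f] by blast
qed

lemma C_k_mono: "C_k k f \<Longrightarrow> l \<le> k \<Longrightarrow> C_k l f"
proof (induction k)
  case (Suc k)
  then show ?case using C_k_Suc_imp[OF Suc.prems(1)] unfolding le_Suc_eq by blast
qed simp

lemma C_k_imp_continuous: "C_k k f \<Longrightarrow> continuous_on UNIV f"
  using C_k_mono[of k f 0] by simp

lemma partial_const [simp]: "partial i (\<lambda>x. c) = (\<lambda>x. 0)"
  by (rule ext, rule trans[OF partial_eqI]) (auto intro!: derivative_eq_intros)

lemma partial_add:
  "f differentiable (at x) \<Longrightarrow> g differentiable (at x) \<Longrightarrow>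
    partial i (\<lambda>x. f x + g x) x = partial i f x + partial i g x"
  unfolding partial_def[of i f] partial_def[of i g] frechet_derivative_works
  by (drule (1) has_derivative_add[THEN partial_eqI, where i = i])

lemma partial_mult:
  "f differentiable (at x) \<Longrightarrow> g differentiable (at x) \<Longrightarrow>
    partial i (\<lambda>x. f x * g x) x = partial i f x * g x + f x * partial i g x"
  unfolding partial_def[of i f] partial_def[of i g] frechet_derivative_works
  by (drule (1) has_derivative_mult[THEN partial_eqI, where i = i]) simp

lemma partial_bounded_linear:
  "bounded_linear L \<Longrightarrow> f differentiable (at x) \<Longrightarrow>
    partial i (\<lambda>x. L (f x)) x = L (partial i f x)"
  unfolding partial_def[of i f] frechet_derivative_works
  by (drule (1) bounded_linear.has_derivative[THEN partial_eqI, where i = i])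

lemma affine_has_derivative:
  fixes f :: "real^3 \<Rightarrow> complex"
  assumes "f differentiable (at (c *\<^sub>R x + b))"
  shows "((\<lambda>x. f (c *\<^sub>R x + b)) has_derivative
           (\<lambda>h. frechet_derivative f (at (c *\<^sub>R x + b)) (c *\<^sub>R h))) (at x)"
proof -
  have "((\<lambda>x. c *\<^sub>R x + b) has_derivative (\<lambda>h. c *\<^sub>R h)) (at x)"
    by (auto intro!: derivative_eq_intros)
  moreover have "(f has_derivative frechet_derivative f (at (c *\<^sub>R x + b))) (at (c *\<^sub>R x + b))"
    using assms frechet_derivative_works by blast
  ultimately show ?thesis
    using diff_chain_at[of "\<lambda>x. c *\<^sub>R x + b" _ x f] by (simp add: o_def)
qed

lemma differentiable_affine:
  fixes f :: "real^3 \<Rightarrow> complex"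
  shows "f differentiable (at (c *\<^sub>R x + b)) \<Longrightarrow> (\<lambda>x. f (c *\<^sub>R x + b)) differentiable (at x)"
  using affine_has_derivative[of f c x b] unfolding differentiable_def by blast

lemma partial_affine:
  assumes "f differentiable (at (c *\<^sub>R x + b))"
  shows "partial i (\<lambda>x. f (c *\<^sub>R x + b)) x = c *\<^sub>R partial i f (c *\<^sub>R x + b)"
proof -
  have "linear (frechet_derivative f (at (c *\<^sub>R x + b)))"
    using assms linear_frechet_derivative by blast
  then show ?thesis
    unfolding partial_eqI[OF affine_has_derivative[OF assms]] partial_def[of i f]
    by (rule linear_scale)
qed

section \<open>Closure properties of the classes C^k\<close>

lemma C_k_const: "C_k k (\<lambda>x. c)"
  by (induction k arbitrary: c) auto

lemma C_k_add: "C_k k f \<Longrightarrow> C_k k g \<Longrightarrow> C_k k (\<lambda>x. f x + g x)"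
proof (induction k arbitrary: f g)
  case (Suc k)
  then have "partial i (\<lambda>x. f x + g x) = (\<lambda>x. partial i f x + partial i g x)" for i
    by (auto simp: partial_add)
  with Suc show ?case by auto
qed (auto intro: continuous_intros)

lemma C_k_mult: "C_k k f \<Longrightarrow> C_k k g \<Longrightarrow> C_k k (\<lambda>x. f x * g x)"
proof (induction k arbitrary: f g)
  case (Suc k)
  then have "partial i (\<lambda>x. f x * g x) = (\<lambda>x. partial i f x * g x + f x * partial i g x)" for i
    by (auto simp: partial_mult)
  with Suc show ?case
    using C_k_Suc_imp[OF Suc.prems(1)] C_k_Suc_imp[OF Suc.prems(2)] by (auto intro!: C_k_add)
qed (auto intro: continuous_intros)

lemma C_k_bounded_linear: "bounded_linear L \<Longrightarrow> C_k k f \<Longrightarrow> C_k k (\<lambda>x. L (f x))"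
proof (induction k arbitrary: f)
  case (Suc k)
  then have "partial i (\<lambda>x. L (f x)) = (\<lambda>x. L (partial i f x))" for i
    by (auto simp: partial_bounded_linear)
  moreover have "(\<lambda>x. L (f x)) differentiable (at x)" for x
  proof -
    obtain f' where "(f has_derivative f') (at x)"
      using Suc.prems(2) by (auto simp: differentiable_def)
    from bounded_linear.has_derivative[OF Suc.prems(1) this] show ?thesis
      by (auto simp: differentiable_def)
  qed
  ultimately show ?case using Suc by auto
qed (auto intro: bounded_linear.continuous_on)

lemma C_k_affine: "C_k k f \<Longrightarrow> C_k k (\<lambda>x. f (c *\<^sub>R x + b))"
proof (induction k arbitrary: f)
  case 0
  then show ?case by (auto intro!: continuous_intros continuous_on_compose2[of UNIV f])
next
  case (Suc k)
  then have "partial i (\<lambda>x. f (c *\<^sub>R x + b)) = (\<lambda>x. c *\<^sub>R partial i f (c *\<^sub>R x + b))" for i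
    by (auto simp: partial_affine)
  moreover have "(\<lambda>x. f (c *\<^sub>R x + b)) differentiable (at x)" for x
    using Suc.prems by (intro differentiable_affine) simp
  moreover have "C_k k (\<lambda>x. c *\<^sub>R partial i f (c *\<^sub>R x + b))" for i
    using Suc by (intro C_k_bounded_linear[OF bounded_linear_scaleR_right]) auto
  ultimately show ?case by auto
qed

lemma C_k_linear:
  assumes "bounded_linear (L :: real^3 \<Rightarrow> complex)" shows "C_k k L"
proof (cases k)
  case 0
  then show ?thesis using assms by (simp add: linear_continuous_on)
next
  case (Suc l)
  have "(L has_derivative L) (at x)" for x
    using assms by (rule bounded_linear_imp_has_derivative)
  then have "L differentiable (at x)" "partial i L = (\<lambda>x. L (axis i 1))" for i x
    by (auto simp: differentiable_def intro!: partial_eqI)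
  then show ?thesis using Suc by (simp add: C_k_const)
qed

text \<open>Intended for gluing: there \<open>U\<close> is an annulus and \<open>g\<close> a piece
  that is C^k on the whole space but agrees with \<open>f\<close> on \<open>U\<close> only.\<close>

lemma C_k_local:
  assumes "\<And>x. \<exists>U g. open U \<and> x \<in> U \<and> C_k k g \<and> (\<forall>y\<in>U. f y = g y)"
  shows "C_k k f"
  using assms
proof (induction k arbitrary: f)
  case 0
  have "isCont f x" for x
  proof -
    obtain U g where U: "open U" "x \<in> U" "C_k 0 g" "\<forall>y\<in>U. f y = g y" using 0[of x] by blast
    then have "isCont g x" by (simp add: continuous_on_eq_continuous_at)
    moreover have "eventually (\<lambda>y. g y = f y) (nhds x)"
      unfolding eventually_nhds using U(1,2,4) by (intro exI[of _ U]) auto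
    ultimately show ?thesis using isCont_cong[of g f x] by simp
  qed
  then show ?case by (simp add: continuous_on_eq_continuous_at)
next
  case (Suc k)
  have "f differentiable (at x)" for x
  proof -
    obtain U g where U: "open U" "x \<in> U" "C_k (Suc k) g" "\<forall>y\<in>U. f y = g y" using Suc.prems[of x] by blast
    then have "g differentiable (at x)" by simp
    then obtain g' where "(g has_derivative g') (at x)" unfolding differentiable_def by blast
    then have "(f has_derivative g') (at x)"
      by (rule has_derivative_transform_within_open[OF _ U(1,2)]) (simp add: U(4))
    then show ?thesis by (auto simp: differentiable_def)
  qed
  moreover have "C_k k (partial i f)" for i
  proof (rule Suc.IH)
    fix x
    obtain U g where U: "open U" "x \<in> U" "C_k (Suc k) g" "\<forall>y\<in>U. f y = g y" using Suc.prems[of x] by blast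
    have "\<forall>y\<in>U. partial i f y = partial i g y"
      by (intro ballI partial_cong_open[OF U(1)] U(4)[rule_format])
    moreover have "C_k k (partial i g)" using U(3) by simp
    ultimately show "\<exists>U g. open U \<and> x \<in> U \<and> C_k k g \<and> (\<forall>y\<in>U. partial i f y = g y)"
      using U(1,2) by blast
  qed
  ultimately show ?case by simp
qed

section \<open>Iterated derivatives of dilated functions\<close>

lemma C_k_partial_funpow: "C_k (n + k) f \<Longrightarrow> C_k k ((partial i ^^ n) f)"
proof (induction n arbitrary: k)
  case (Suc n)
  have "C_k (Suc k) ((partial i ^^ n) f)" by (rule Suc.IH) (use Suc.prems in simp)
  then show ?case by simp
qed simp

lemma partial_funpow_scale:
  "C_k n f \<Longrightarrow> (partial i ^^ n) (\<lambda>x. f (c *\<^sub>R x)) = (\<lambda>x. c ^ n *\<^sub>R (partial i ^^ n) f (c *\<^sub>R x))"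
proof (induction n)
  case (Suc n)
  let ?g = "(partial i ^^ n) f"
  have "C_k (Suc 0) ?g"
    by (rule C_k_partial_funpow) (use Suc.prems in simp)
  then have d: "?g differentiable (at x)" for x by simp
  have "(partial i ^^ Suc n) (\<lambda>x. f (c *\<^sub>R x)) = partial i (\<lambda>x. c ^ n *\<^sub>R ?g (c *\<^sub>R x))"
    using Suc.IH[OF C_k_Suc_imp[OF Suc.prems]] by simp
  also have "\<dots> = (\<lambda>x. c ^ n *\<^sub>R (c *\<^sub>R partial i ?g (c *\<^sub>R x)))"
  proof
    fix x
    have "partial i (\<lambda>x. c ^ n *\<^sub>R ?g (c *\<^sub>R x)) x = c ^ n *\<^sub>R partial i (\<lambda>x. ?g (c *\<^sub>R x)) x"
      using differentiable_affine[of ?g c x 0] d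
      by (intro partial_bounded_linear[OF bounded_linear_scaleR_right[of "c ^ n"]]) simp
    then show "partial i (\<lambda>x. c ^ n *\<^sub>R ?g (c *\<^sub>R x)) x = c ^ n *\<^sub>R (c *\<^sub>R partial i ?g (c *\<^sub>R x))"
      using partial_affine[of ?g c x 0 i] d by simp
  qed
  finally show ?case by (simp add: mult.commute)
qed simp

lemma partial_funpow_scaleR:
  "C_k n f \<Longrightarrow> (partial i ^^ n) (\<lambda>x. c *\<^sub>R f x) = (\<lambda>x. c *\<^sub>R (partial i ^^ n) f x)"
proof (induction n)
  case (Suc n)
  let ?g = "(partial i ^^ n) f"
  have "C_k (Suc 0) ?g"
    by (rule C_k_partial_funpow) (use Suc.prems in simp)
  then have d: "?g differentiable (at x)" for x by simp
  have "partial i (\<lambda>x. c *\<^sub>R ?g x) = (\<lambda>x. c *\<^sub>R partial i ?g x)"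
    by (intro ext partial_bounded_linear[OF bounded_linear_scaleR_right[of c]] d)
  then show ?case
    by (simp only: funpow.simps o_apply Suc.IH[OF C_k_Suc_imp[OF Suc.prems]])
qed simp

lemma order_mi_3: "order_mi \<alpha> = \<alpha> $ 1 + \<alpha> $ 2 + \<alpha> $ 3"
  unfolding order_mi_def by (rule sum_3)

text \<open>The factor \<open>d\<close> collects the powers of \<open>c\<close> already pulled out
  by the inner derivatives of \<open>mderiv\<close>, so that one rule serves each further
  coordinate.\<close>

lemma partial_funpow_scaleR_scale:
  assumes "C_k n f"
  shows "(partial i ^^ n) (\<lambda>x. d *\<^sub>R f (c *\<^sub>R x)) =
    (\<lambda>x. (d * c ^ n) *\<^sub>R (partial i ^^ n) f (c *\<^sub>R x))"
proof -
  have "C_k n (\<lambda>x. f (c *\<^sub>R x))" using C_k_affine[OF assms, of c 0] by simp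
  from partial_funpow_scaleR[OF this, of i d] show ?thesis
    unfolding partial_funpow_scale[OF assms, of i c] scaleR_scaleR .
qed

lemma mderiv_scale:
  assumes "C_k (order_mi \<alpha>) f"
  shows "mderiv \<alpha> (\<lambda>x. f (c *\<^sub>R x)) = (\<lambda>x. c ^ order_mi \<alpha> *\<^sub>R mderiv \<alpha> f (c *\<^sub>R x))"
proof -
  let ?g = "(partial 3 ^^ (\<alpha> $ 3)) f"
  let ?h = "(partial 2 ^^ (\<alpha> $ 2)) ?g"
  have 1: "C_k (\<alpha> $ 3) f" using assms by (rule C_k_mono) (simp add: order_mi_3)
  have g: "C_k (\<alpha> $ 2 + \<alpha> $ 1) ?g"
    using C_k_partial_funpow[of "\<alpha> $ 3" "\<alpha> $ 2 + \<alpha> $ 1" f] assms by (simp add: order_mi_3 ac_simps)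
  then have h: "C_k (\<alpha> $ 1) ?h" by (rule C_k_partial_funpow)
  have g': "C_k (\<alpha> $ 2) ?g" using g by (rule C_k_mono) simp
  show ?thesis
    unfolding mderiv_def partial_funpow_scale[OF 1, of 3 c]
      partial_funpow_scaleR_scale[OF g', of 2 "c ^ (\<alpha> $ 3)" c]
      partial_funpow_scaleR_scale[OF h, of 1 "c ^ (\<alpha> $ 3) * c ^ (\<alpha> $ 2)" c]
    by (simp add: order_mi_3 power_add mult_ac)
qed

section \<open>Smooth functions, the Leibniz rule and plane waves\<close>

lemma smooth_imp_C_k: "smooth f \<Longrightarrow> C_k k f" by (simp add: smooth_def)

lemma smooth_differentiable: "smooth f \<Longrightarrow> f differentiable (at x)"
  using smooth_imp_C_k[of f 1] by simp

lemma smooth_continuous: "smooth f \<Longrightarrow> continuous_on UNIV f"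
  using smooth_imp_C_k[of f 0] by simp

lemma smooth_partial: "smooth f \<Longrightarrow> smooth (partial i f)"
  unfolding smooth_def
proof
  fix k assume "\<forall>k. C_k k f"
  then have "C_k (Suc k) f" ..
  then show "C_k k (partial i f)" by simp
qed

lemma smooth_partial_funpow: "smooth f \<Longrightarrow> smooth ((partial i ^^ n) f)"
  by (induction n) (auto simp: smooth_partial)

lemma smooth_const [simp]: "smooth (\<lambda>x. c)" by (simp add: smooth_def C_k_const)

lemma smooth_add: "smooth f \<Longrightarrow> smooth g \<Longrightarrow> smooth (\<lambda>x. f x + g x)"
  by (simp add: smooth_def C_k_add)

lemma smooth_mult: "smooth f \<Longrightarrow> smooth g \<Longrightarrow> smooth (\<lambda>x. f x * g x)"
  by (simp add: smooth_def C_k_mult)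

lemma smooth_sum: "(\<And>k. k \<in> A \<Longrightarrow> smooth (f k)) \<Longrightarrow> smooth (\<lambda>x. \<Sum>k\<in>A. f k x)"
  by (induction A rule: infinite_finite_induct) (auto intro: smooth_add)

lemma smooth_affine: "smooth f \<Longrightarrow> smooth (\<lambda>x. f (c *\<^sub>R x + b))"
  by (simp add: smooth_def C_k_affine)

lemma smooth_scale: "smooth f \<Longrightarrow> smooth (\<lambda>x. f (c *\<^sub>R x))"
  using smooth_affine[of f c 0] by simp

lemma partial_funpow_sum:
  assumes "\<And>k. k \<in> A \<Longrightarrow> smooth (F k)"
  shows "(partial i ^^ n) (\<lambda>x. \<Sum>k\<in>A. c k * F k x) = (\<lambda>x. \<Sum>k\<in>A. c k * (partial i ^^ n) (F k) x)"
proof (induction n)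
  case (Suc n)
  have one: "partial i (\<lambda>x. \<Sum>k\<in>A. c k * G k x) = (\<lambda>x. \<Sum>k\<in>A. c k * partial i (G k) x)"
    if "\<And>k. k \<in> A \<Longrightarrow> smooth (G k)" for G
    using that
  proof (induction A rule: infinite_finite_induct)
    case (insert a A)
    then show ?case
      by (auto simp: fun_eq_iff partial_add partial_mult smooth_differentiable smooth_sum smooth_mult)
  qed auto
  show ?case
    using one[of "\<lambda>k. (partial i ^^ n) (F k)"] assms by (simp add: Suc smooth_partial_funpow)
qed simp

lemma mderiv_sum:
  assumes "\<And>k. k \<in> A \<Longrightarrow> smooth (F k)"
  shows "mderiv \<alpha> (\<lambda>x. \<Sum>k\<in>A. c k * F k x) = (\<lambda>x. \<Sum>k\<in>A. c k * mderiv \<alpha> (F k) x)"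
  unfolding mderiv_def using assms
  by (simp add: partial_funpow_sum smooth_partial_funpow)

lemma mderiv_lincomb:
  assumes "smooth f" "smooth g"
  shows "mderiv \<alpha> (\<lambda>x. a * f x + b * g x) = (\<lambda>x. a * mderiv \<alpha> f x + b * mderiv \<alpha> g x)"
  using mderiv_sum[of "UNIV :: bool set" "\<lambda>k. if k then f else g" \<alpha> "\<lambda>k. if k then a else b"] assms
  by (simp add: UNIV_bool add.commute)

lemma partial_funpow_mult:
  assumes "smooth f" "smooth g"
  shows "(partial i ^^ n) (\<lambda>x. f x * g x) =
    (\<lambda>x. \<Sum>k\<le>n. of_nat (n choose k) * ((partial i ^^ k) f x * (partial i ^^ (n - k)) g x))"
proof (induction n)
  case (Suc n)
  let ?p = "\<lambda>k. (partial i ^^ k) f" and ?q = "\<lambda>k. (partial i ^^ k) g"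
  have sm: "smooth (\<lambda>x. ?p k x * ?q l x)" for k l
    using assms by (intro smooth_mult smooth_partial_funpow)
  have "(partial i ^^ Suc n) (\<lambda>x. f x * g x) =
     (\<lambda>x. \<Sum>k\<le>n. of_nat (n choose k) * partial i (\<lambda>x. ?p k x * ?q (n - k) x) x)"
    using partial_funpow_sum[of "{..n}" "\<lambda>k x. ?p k x * ?q (n - k) x" 1 i] sm by (simp add: Suc)
  also have "\<dots> = (\<lambda>x. \<Sum>k\<le>n. of_nat (n choose k) * (?p (Suc k) x * ?q (n - k) x + ?p k x * ?q (Suc n - k) x))"
    using assms by (auto simp: fun_eq_iff partial_mult smooth_differentiable smooth_partial_funpow Suc_diff_le intro!: sum.cong)
  also have "\<dots> = (\<lambda>x. \<Sum>k\<le>Suc n. of_nat (Suc n choose k) * (?p k x * ?q (Suc n - k) x))"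
  proof
    fix x
    have "(\<Sum>k\<le>Suc n. of_nat (Suc n choose k) * (?p k x * ?q (Suc n - k) x)) =
       f x * ?q (Suc n) x + (\<Sum>k\<le>n. of_nat (Suc n choose Suc k) * (?p (Suc k) x * ?q (n - k) x))"
      by (subst sum.atMost_Suc_shift) simp
    also have "\<dots> = f x * ?q (Suc n) x + (\<Sum>k\<le>n. of_nat (n choose k) * (?p (Suc k) x * ?q (n - k) x))
        + (\<Sum>k\<le>n. of_nat (n choose Suc k) * (?p (Suc k) x * ?q (n - k) x))"
      by (simp add: sum.distrib algebra_simps)
    finally have 1: "(\<Sum>k\<le>Suc n. of_nat (Suc n choose k) * (?p k x * ?q (Suc n - k) x)) = \<dots>" .
    have "f x * ?q (Suc n) x + (\<Sum>k\<le>n. of_nat (n choose Suc k) * (?p (Suc k) x * ?q (n - k) x)) =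
       (\<Sum>k\<le>Suc n. of_nat (n choose k) * (?p k x * ?q (Suc n - k) x))"
      by (subst sum.atMost_Suc_shift) simp
    \<comment> \<open>The summand with \<open>k = Suc n\<close> drops out because its binomial
      coefficient is zero; together with Pascal's rule in \<open>1\<close> this closes the
      induction.\<close>
    also have "\<dots> = (\<Sum>k\<le>n. of_nat (n choose k) * (?p k x * ?q (Suc n - k) x))" by simp
    finally have 2: "(\<Sum>k\<le>n. of_nat (n choose k) * (?p k x * ?q (Suc n - k) x)) =
        f x * ?q (Suc n) x + (\<Sum>k\<le>n. of_nat (n choose Suc k) * (?p (Suc k) x * ?q (n - k) x))" ..
    show "(\<Sum>k\<le>n. of_nat (n choose k) * (?p (Suc k) x * ?q (n - k) x + ?p k x * ?q (Suc n - k) x)) =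
      (\<Sum>k\<le>Suc n. of_nat (Suc n choose k) * (?p k x * ?q (Suc n - k) x))"
      unfolding 1 distrib_left sum.distrib 2 by (simp only: add_ac)
  qed
  finally show ?case .
qed simp

text \<open>Plane waves serve as multipliers of test functions when the transform of a derivative is
  computed by parts. A derivative of a plane wave is a constant multiple of it, which drives the
  induction on \<open>k\<close>.\<close>

lemma C_k_cis: "C_k k (\<lambda>y. cis (y \<bullet> \<xi>))"
  and partial_cis: "partial i (\<lambda>y. cis (y \<bullet> \<xi>)) = (\<lambda>y. \<i> * of_real (\<xi> $ i) * cis (y \<bullet> \<xi>))"
proof -
  have d: "((\<lambda>y. cis (y \<bullet> \<xi>)) has_derivative (\<lambda>h. (h \<bullet> \<xi>) *\<^sub>R (\<i> * cis (y \<bullet> \<xi>)))) (at y)" for y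
  proof -
    have "((\<lambda>y. \<i> * complex_of_real (y \<bullet> \<xi>)) has_derivative (\<lambda>h. \<i> * of_real (h \<bullet> \<xi>))) (at y)"
      by (auto intro!: derivative_eq_intros)
    from has_derivative_compose[OF this DERIV_exp[unfolded has_field_derivative_def]]
    show ?thesis by (simp add: cis_conv_exp scaleR_conv_of_real mult_ac)
  qed
  show p: "partial i (\<lambda>y. cis (y \<bullet> \<xi>)) = (\<lambda>y. \<i> * of_real (\<xi> $ i) * cis (y \<bullet> \<xi>))" for i
    by (rule ext, subst partial_eqI[OF d]) (simp add: inner_axis' scaleR_conv_of_real)
  show "C_k k (\<lambda>y. cis (y \<bullet> \<xi>))"
  proof (induction k)
    case (Suc k)
    have "(\<lambda>y. cis (y \<bullet> \<xi>)) differentiable (at y)" for y using d by (auto simp: differentiable_def)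
    with Suc show ?case by (simp add: p C_k_mult C_k_const)
  qed (auto intro!: continuous_intros)
qed

section \<open>Fourier integrals and moments\<close>


text \<open>One power of the weight pays for one derivative of the Fourier integral of
  \<open>g\<close>.\<close>

definition finite_moment :: "nat \<Rightarrow> (real^3 \<Rightarrow> complex) \<Rightarrow> bool"
  where "finite_moment k g \<longleftrightarrow> g \<in> borel_measurable borel \<and>
    integrable lborel (\<lambda>\<xi>. (1 + norm \<xi>) ^ k * norm (g \<xi>))"

text \<open>The sign in the exponent is opposite to that of \<open>fourier\<close>, and there is no
  normalising constant: up to the factor (2 pi)^(-3/2) this is the inverse transform.\<close>

definition ft :: "(real^3 \<Rightarrow> complex) \<Rightarrow> real^3 \<Rightarrow> complex"
  where "ft g x = (LINT \<xi>|lborel. cis (x \<bullet> \<xi>) * g \<xi>)"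

lemma measurable_cis [measurable]: "cis \<in> borel_measurable borel"
  by (intro borel_measurable_continuous_onI continuous_intros)

lemma finite_momentI:
  assumes "finite_moment k g" and [measurable]: "h \<in> borel_measurable borel"
    and "\<And>\<xi>. (1 + norm \<xi>) ^ l * norm (h \<xi>) \<le> c * ((1 + norm \<xi>) ^ k * norm (g \<xi>))"
  shows "finite_moment l h"
  unfolding finite_moment_def
proof
  show "integrable lborel (\<lambda>\<xi>. (1 + norm \<xi>) ^ l * norm (h \<xi>))"
  proof (rule Bochner_Integration.integrable_bound)
    show "integrable lborel (\<lambda>\<xi>. c * ((1 + norm \<xi>) ^ k * norm (g \<xi>)))"
      using assms(1) by (simp add: finite_moment_def)
    show "AE \<xi> in lborel. norm ((1 + norm \<xi>) ^ l * norm (h \<xi>)) \<le>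
        norm (c * ((1 + norm \<xi>) ^ k * norm (g \<xi>)))"
      using assms(3) by (intro AE_I2) (smt (verit, best) mult_nonneg_nonneg norm_ge_zero real_norm_def zero_le_power)
  qed simp
qed fact

lemma finite_moment_mult:
  assumes "finite_moment (n + k) g" "p \<in> borel_measurable borel" "\<And>\<xi>. norm (p \<xi>) \<le> norm \<xi> ^ n"
  shows "finite_moment k (\<lambda>\<xi>. p \<xi> * g \<xi>)"
proof (rule finite_momentI[OF assms(1), where c = 1])
  show "(\<lambda>\<xi>. p \<xi> * g \<xi>) \<in> borel_measurable borel"
    using assms by (auto simp: finite_moment_def)
  fix \<xi> :: "real^3"
  have "norm (p \<xi>) \<le> (1 + norm \<xi>) ^ n"
    using assms(3)[of \<xi>] power_mono[of "norm \<xi>" "1 + norm \<xi>" n] by simp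
  then have "(1 + norm \<xi>) ^ k * norm (g \<xi>) * norm (p \<xi>) \<le> (1 + norm \<xi>) ^ k * norm (g \<xi>) * (1 + norm \<xi>) ^ n"
    by (intro mult_left_mono) auto
  then show "(1 + norm \<xi>) ^ k * norm (p \<xi> * g \<xi>) \<le> 1 * ((1 + norm \<xi>) ^ (n + k) * norm (g \<xi>))"
    by (simp add: norm_mult power_add mult_ac)
qed

lemma finite_moment_mono:
  assumes "finite_moment (n + k) g" shows "finite_moment k g"
proof (rule finite_momentI[OF assms, where c = 1])
  fix \<xi> :: "real^3"
  have "1 \<le> (1 + norm \<xi>) ^ n" by (rule one_le_power) simp
  then have "(1 + norm \<xi>) ^ k * norm (g \<xi>) * 1 \<le> (1 + norm \<xi>) ^ k * norm (g \<xi>) * (1 + norm \<xi>) ^ n"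
    by (intro mult_left_mono) auto
  then show "(1 + norm \<xi>) ^ k * norm (g \<xi>) \<le> 1 * ((1 + norm \<xi>) ^ (n + k) * norm (g \<xi>))"
    by (simp add: power_add mult_ac)
qed (use assms in \<open>simp add: finite_moment_def\<close>)

lemma finite_moment_0: "finite_moment 0 g \<longleftrightarrow> integrable lborel g"
  unfolding finite_moment_def
  by (auto simp: integrable_norm_iff dest: borel_measurable_integrable)

lemma finite_moment_integrable: "finite_moment k g \<Longrightarrow> integrable lborel g"
  using finite_moment_mono[of k 0] by (simp add: finite_moment_0)

lemma integrable_cis_mult:
  assumes "integrable lborel g"
  shows "integrable lborel (\<lambda>\<xi>. cis (x \<bullet> \<xi>) * g \<xi>)"
proof (rule Bochner_Integration.integrable_bound[OF assms])
  have [measurable]: "g \<in> borel_measurable borel" using assms by (auto dest: borel_measurable_integrable)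
  show "(\<lambda>\<xi>. cis (x \<bullet> \<xi>) * g \<xi>) \<in> borel_measurable lborel" by measurable
qed (simp add: norm_mult)

lemma norm_ft_le: "integrable lborel g \<Longrightarrow> norm (ft g x) \<le> (LINT \<xi>|lborel. norm (g \<xi>))"
  unfolding ft_def using integral_norm_bound[of lborel "\<lambda>\<xi>. cis (x \<bullet> \<xi>) * g \<xi>"]
  by (simp add: norm_mult)

lemma continuous_ft:
  assumes "integrable lborel g" shows "continuous_on UNIV (ft g)"
proof (rule continuous_on_sequentiallyI)
  fix u :: "nat \<Rightarrow> real^3" and a assume u: "u \<longlonglongrightarrow> a"
  have [measurable]: "g \<in> borel_measurable borel" using assms by (auto dest: borel_measurable_integrable)
  show "(\<lambda>n. ft g (u n)) \<longlonglongrightarrow> ft g a"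
    unfolding ft_def
  proof (rule integral_dominated_convergence)
    show "integrable lborel (\<lambda>\<xi>. norm (g \<xi>))" using assms by simp
    show "AE \<xi> in lborel. (\<lambda>i. cis (u i \<bullet> \<xi>) * g \<xi>) \<longlonglongrightarrow> cis (a \<bullet> \<xi>) * g \<xi>"
      using u by (intro AE_I2 tendsto_intros isCont_tendsto_compose[of _ cis] continuous_intros) auto
  qed (auto simp: norm_mult)
qed

text \<open>Two bounds for two purposes in differentiating a Fourier integral: the quadratic one
  gives pointwise convergence of the remainder quotients, the linear one a dominating function with
  just a first moment of the density.\<close>

lemma norm_cis_remainder_le:
  "norm (cis t - 1 - \<i> * t) \<le> t\<^sup>2 / 2" "norm (cis t - 1 - \<i> * t) \<le> 2 * \<bar>t\<bar>"
  using iexp_approx1[of t 1] iexp_approx2[of t 1]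
  by (simp_all add: cis_conv_exp diff_diff_eq numeral_2_eq_2)

text \<open>Dominated convergence along an arbitrary sequence tending to \<open>x\<close>. A second
  moment of \<open>g\<close> may be infinite; the quadratic bound is therefore used for each fixed
  \<xi> and never integrated.\<close>

lemma ft_has_derivative:
  assumes "finite_moment 1 g"
  shows "(ft g has_derivative (\<lambda>h. LINT \<xi>|lborel. cis (x \<bullet> \<xi>) * (\<i> * of_real (h \<bullet> \<xi>) * g \<xi>))) (at x)"
    (is "(_ has_derivative ?D) _")
proof -
  have [measurable]: "g \<in> borel_measurable borel" using assms by (simp add: finite_moment_def)
  have ig: "integrable lborel g" using assms by (rule finite_moment_integrable)
  have i1: "integrable lborel (\<lambda>\<xi>. norm \<xi> * norm (g \<xi>))"
  proof (rule Bochner_Integration.integrable_bound)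
    show "integrable lborel (\<lambda>\<xi>. (1 + norm \<xi>) * norm (g \<xi>))"
      using assms by (simp add: finite_moment_def)
  qed (auto simp: mult_right_mono)
  have nb: "norm (cis (x \<bullet> \<xi>) * (\<i> * of_real (h \<bullet> \<xi>) * g \<xi>)) \<le> norm h * (norm \<xi> * norm (g \<xi>))" for h \<xi>
    using mult_right_mono[OF Cauchy_Schwarz_ineq2[of h \<xi>], of "norm (g \<xi>)"]
    by (simp add: norm_mult mult_ac)
  have ih: "integrable lborel (\<lambda>\<xi>. cis (x \<bullet> \<xi>) * (\<i> * of_real (h \<bullet> \<xi>) * g \<xi>))" for h
    using nb by (intro Bochner_Integration.integrable_bound[OF integrable_mult_right[OF i1, of "norm h"]])
      (auto intro!: AE_I2)
  have bl: "bounded_linear ?D"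
  proof (rule bounded_linear_intro[where K = "LINT \<xi>|lborel. norm \<xi> * norm (g \<xi>)"])
    show "?D (a + b) = ?D a + ?D b" for a b
      using Bochner_Integration.integral_add[OF ih[of a] ih[of b]]
      by (simp add: inner_add_left algebra_simps)
    show "?D (r *\<^sub>R a) = r *\<^sub>R ?D a" for r a
      unfolding Bochner_Integration.integral_scaleR_right[symmetric]
      by (intro Bochner_Integration.integral_cong) (auto simp: scaleR_conv_of_real[where 'a = complex])
    show "norm (?D h) \<le> norm h * (LINT \<xi>|lborel. norm \<xi> * norm (g \<xi>))" for h
      using Bochner_Integration.integral_norm_bound_integral[OF ih integrable_mult_right[OF i1, of "norm h"] nb]
      by simp
  qed
  have "(\<lambda>y. norm (ft g y - ft g x - ?D (y - x)) / norm (y - x)) \<midarrow>x\<rightarrow> 0"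
    unfolding tendsto_at_iff_sequentially o_def
  proof (intro allI impI)
    fix X :: "nat \<Rightarrow> real^3" assume X: "\<forall>i. X i \<in> UNIV - {x}" "X \<longlonglongrightarrow> x"
    define r where "r n \<xi> = norm (cis ((X n - x) \<bullet> \<xi>) - 1 - \<i> * of_real ((X n - x) \<bullet> \<xi>)) / norm (X n - x) * norm (g \<xi>)" for n \<xi>
    have Xx: "norm (X n - x) > 0" for n using X(1) by auto
    have [measurable]: "r n \<in> borel_measurable borel" for n unfolding r_def by measurable
    have r1: "norm (r n \<xi>) \<le> 2 * (norm \<xi> * norm (g \<xi>))" for n \<xi>
    proof -
      have "norm (cis ((X n - x) \<bullet> \<xi>) - 1 - \<i> * of_real ((X n - x) \<bullet> \<xi>)) \<le> 2 * (norm (X n - x) * norm \<xi>)"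
        using norm_cis_remainder_le(2)[of "(X n - x) \<bullet> \<xi>"] Cauchy_Schwarz_ineq2[of "X n - x" \<xi>] by linarith
      then have "norm (cis ((X n - x) \<bullet> \<xi>) - 1 - \<i> * of_real ((X n - x) \<bullet> \<xi>)) / norm (X n - x) \<le> 2 * norm \<xi>"
        using Xx[of n] by (simp add: divide_le_eq mult_ac)
      from mult_right_mono[OF this, of "norm (g \<xi>)"] show ?thesis
        by (simp add: r_def mult_ac)
    qed
    have r2: "norm (r n \<xi>) \<le> norm (X n - x) * (norm \<xi> ^ 2 / 2 * norm (g \<xi>))" for n \<xi>
    proof -
      have "((X n - x) \<bullet> \<xi>)\<^sup>2 \<le> (norm (X n - x) * norm \<xi>)\<^sup>2"
        using power_mono[OF Cauchy_Schwarz_ineq2[of "X n - x" \<xi>], of 2] by simp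
      then have "norm (cis ((X n - x) \<bullet> \<xi>) - 1 - \<i> * of_real ((X n - x) \<bullet> \<xi>)) \<le> (norm (X n - x) * norm \<xi>)\<^sup>2 / 2"
        using norm_cis_remainder_le(1)[of "(X n - x) \<bullet> \<xi>"] by linarith
      then have "norm (cis ((X n - x) \<bullet> \<xi>) - 1 - \<i> * of_real ((X n - x) \<bullet> \<xi>)) / norm (X n - x) \<le> norm (X n - x) * (norm \<xi> ^ 2 / 2)"
        using Xx[of n] by (simp add: divide_le_eq power2_eq_square mult_ac)
      from mult_right_mono[OF this, of "norm (g \<xi>)"] show ?thesis
        by (simp add: r_def mult_ac)
    qed
    have ir: "integrable lborel (r n)" for n
      using r1 by (intro Bochner_Integration.integrable_bound[OF integrable_mult_right[OF i1, of 2]])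
        (auto intro!: AE_I2)
    have "(\<lambda>n. LINT \<xi>|lborel. r n \<xi>) \<longlonglongrightarrow> integral\<^sup>L (lborel :: (real^3) measure) (\<lambda>\<xi>. 0)"
    proof (rule integral_dominated_convergence)
      show "integrable lborel (\<lambda>\<xi>. 2 * (norm \<xi> * norm (g \<xi>)))" using i1 by simp
      show "AE \<xi> in lborel. (\<lambda>n. r n \<xi>) \<longlonglongrightarrow> 0"
      proof (rule AE_I2, rule Lim_null_comparison[OF always_eventually])
        fix \<xi> :: "real^3"
        show "\<forall>n. norm (r n \<xi>) \<le> norm (X n - x) * (norm \<xi> ^ 2 / 2 * norm (g \<xi>))" using r2 by blast
        have "(\<lambda>n. norm (X n - x)) \<longlonglongrightarrow> 0" using X(2) LIM_zero tendsto_norm_zero by blast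
        then show "(\<lambda>n. norm (X n - x) * (norm \<xi> ^ 2 / 2 * norm (g \<xi>))) \<longlonglongrightarrow> 0"
          by (rule tendsto_mult_left_zero)
      qed
    qed (use r1 in auto)
    then have lim: "(\<lambda>n. LINT \<xi>|lborel. r n \<xi>) \<longlonglongrightarrow> 0" by simp
    have "norm (ft g (X n) - ft g x - ?D (X n - x)) / norm (X n - x) \<le> (LINT \<xi>|lborel. r n \<xi>)" for n
    proof -
      \<comment> \<open>Factoring out the value at \<open>x\<close>, of modulus 1, leaves a
        remainder that depends on the increment alone.\<close>
      have e: "cis (X n \<bullet> \<xi>) = cis (x \<bullet> \<xi>) * cis ((X n - x) \<bullet> \<xi>)" for \<xi>
        by (simp add: cis_mult inner_diff_left)
      have "ft g (X n) - ft g x - ?D (X n - x) = (LINT \<xi>|lborel. cis (X n \<bullet> \<xi>) * g \<xi> - cis (x \<bullet> \<xi>) * g \<xi>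
           - cis (x \<bullet> \<xi>) * (\<i> * of_real ((X n - x) \<bullet> \<xi>) * g \<xi>))"
        unfolding ft_def using ig ih by (simp add: integrable_cis_mult)
      also have "\<dots> = (LINT \<xi>|lborel. cis (x \<bullet> \<xi>) * (cis ((X n - x) \<bullet> \<xi>) - 1 - \<i> * of_real ((X n - x) \<bullet> \<xi>)) * g \<xi>)"
        unfolding e by (simp add: algebra_simps)
      finally have "norm (ft g (X n) - ft g x - ?D (X n - x)) \<le>
          (LINT \<xi>|lborel. norm (cis (x \<bullet> \<xi>) * (cis ((X n - x) \<bullet> \<xi>) - 1 - \<i> * of_real ((X n - x) \<bullet> \<xi>)) * g \<xi>))"
        by (simp only: integral_norm_bound)
      also have "\<dots> = (LINT \<xi>|lborel. norm (X n - x) * r n \<xi>)"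
        using Xx[of n] unfolding r_def by (intro Bochner_Integration.integral_cong) (auto simp: norm_mult)
      also have "\<dots> = norm (X n - x) * (LINT \<xi>|lborel. r n \<xi>)" by simp
      finally show ?thesis using Xx[of n] by (simp add: divide_le_eq mult_ac)
    qed
    then show "(\<lambda>n. norm (ft g (X n) - ft g x - ?D (X n - x)) / norm (X n - x)) \<longlonglongrightarrow> 0"
      by (intro Lim_null_comparison[OF _ lim] always_eventually) auto
  qed
  with bl show ?thesis by (simp add: has_derivative_iff_norm)
qed

lemma partial_ft:
  "finite_moment 1 g \<Longrightarrow> partial i (ft g) = ft (\<lambda>\<xi>. \<i> * of_real (\<xi> $ i) * g \<xi>)"
  by (rule ext, subst partial_eqI[OF ft_has_derivative]) (auto simp: ft_def inner_axis')

lemma finite_moment_coord: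
  assumes "finite_moment (n + k) g"
  shows "finite_moment k (\<lambda>\<xi>. (\<i> * of_real (\<xi> $ i)) ^ n * g \<xi>)"
proof (rule finite_moment_mult[OF assms])
  show "(\<lambda>\<xi>::real^3. (\<i> * complex_of_real (\<xi> $ i)) ^ n) \<in> borel_measurable borel"
    by (intro borel_measurable_continuous_onI continuous_intros)
  show "norm ((\<i> * complex_of_real (\<xi> $ i)) ^ n) \<le> norm \<xi> ^ n" for \<xi> :: "real^3"
    using component_le_norm_cart[of \<xi> i] by (simp add: norm_mult norm_power power_mono)
qed

lemma C_k_ft: "finite_moment k g \<Longrightarrow> C_k k (ft g)"
proof (induction k arbitrary: g)
  case 0
  then show ?case by (simp add: finite_moment_0 continuous_ft)
next
  case (Suc k)
  then have 1: "finite_moment 1 g" using finite_moment_mono[of k 1 g] by simp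
  have "finite_moment k (\<lambda>\<xi>. \<i> * of_real (\<xi> $ i) * g \<xi>)" for i
    using finite_moment_coord[of 1 k g i] Suc.prems by simp
  then have "C_k k (partial i (ft g))" for i
    unfolding partial_ft[OF 1] by (rule Suc.IH)
  moreover have "ft g differentiable (at x)" for x
    using ft_has_derivative[OF 1] by (auto simp: differentiable_def)
  ultimately show ?case by simp
qed

lemma partial_funpow_ft:
  "finite_moment n g \<Longrightarrow> (partial i ^^ n) (ft g) = ft (\<lambda>\<xi>. (\<i> * of_real (\<xi> $ i)) ^ n * g \<xi>)"
proof (induction n)
  case (Suc n)
  have 1: "finite_moment n g" using finite_moment_mono[of 1 n g] Suc.prems by simp
  have "finite_moment 1 (\<lambda>\<xi>. (\<i> * of_real (\<xi> $ i)) ^ n * g \<xi>)"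
    by (rule finite_moment_coord) (use Suc.prems in simp)
  then show ?case by (simp add: Suc.IH[OF 1] partial_ft mult_ac)
qed simp

text \<open>The symbol (i \<xi>)^\<alpha> by which \<open>mderiv \<alpha>\<close> acts on the
  density of a Fourier integral.\<close>

definition imon :: "multi_index \<Rightarrow> real^3 \<Rightarrow> complex"
  where "imon \<alpha> \<xi> = (\<i> * of_real (\<xi> $ 1)) ^ (\<alpha> $ 1) * (\<i> * of_real (\<xi> $ 2)) ^ (\<alpha> $ 2) * (\<i> * of_real (\<xi> $ 3)) ^ (\<alpha> $ 3)"

lemma norm_imon_le: "norm (imon \<alpha> \<xi>) \<le> norm \<xi> ^ order_mi \<alpha>"
proof -
  have *: "\<bar>\<xi> $ i\<bar> ^ n \<le> norm \<xi> ^ n" for i n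
    using component_le_norm_cart[of \<xi> i] by (simp add: power_mono)
  have "\<bar>\<xi> $ 1\<bar> ^ (\<alpha> $ 1) * \<bar>\<xi> $ 2\<bar> ^ (\<alpha> $ 2) * \<bar>\<xi> $ 3\<bar> ^ (\<alpha> $ 3) \<le> norm \<xi> ^ (\<alpha> $ 1) * norm \<xi> ^ (\<alpha> $ 2) * norm \<xi> ^ (\<alpha> $ 3)"
    by (intro mult_mono *) auto
  then show ?thesis by (simp add: imon_def norm_mult norm_power order_mi_3 power_add)
qed

lemma continuous_imon: "continuous_on UNIV (imon \<alpha>)"
  unfolding imon_def by (intro continuous_intros)

lemma finite_moment_imon: "finite_moment (order_mi \<alpha> + k) g \<Longrightarrow> finite_moment k (\<lambda>\<xi>. imon \<alpha> \<xi> * g \<xi>)"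
  by (rule finite_moment_mult) (auto simp: norm_imon_le intro: borel_measurable_continuous_onI continuous_imon)

lemma mderiv_ft:
  assumes "finite_moment (order_mi \<alpha>) g"
  shows "mderiv \<alpha> (ft g) = ft (\<lambda>\<xi>. imon \<alpha> \<xi> * g \<xi>)"
proof -
  let ?c = "\<lambda>i \<xi>. \<i> * complex_of_real (\<xi> $ i)"
  let ?g = "\<lambda>\<xi>. ?c 3 \<xi> ^ (\<alpha> $ 3) * g \<xi>" let ?h = "\<lambda>\<xi>. ?c 2 \<xi> ^ (\<alpha> $ 2) * ?g \<xi>"
  have "finite_moment (\<alpha> $ 3 + (\<alpha> $ 2 + \<alpha> $ 1)) g"
    using assms by (simp add: order_mi_3 ac_simps)
  then have g: "finite_moment (\<alpha> $ 2 + \<alpha> $ 1) ?g" by (rule finite_moment_coord)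
  then have h: "finite_moment (\<alpha> $ 1) ?h" by (rule finite_moment_coord)
  have f': "finite_moment (\<alpha> $ 3) g"
    using assms finite_moment_mono[of "\<alpha> $ 1 + \<alpha> $ 2" "\<alpha> $ 3" g] by (simp add: order_mi_3)
  have g': "finite_moment (\<alpha> $ 2) ?g"
    using g finite_moment_mono[of "\<alpha> $ 1" "\<alpha> $ 2" ?g] by (simp add: add.commute)
  show ?thesis
    unfolding mderiv_def partial_funpow_ft[OF f'] partial_funpow_ft[OF g'] partial_funpow_ft[OF h]
    by (simp add: imon_def mult_ac)
qed

section \<open>Test functions\<close>


lemma integrable_compact_support:
  fixes f :: "real^3 \<Rightarrow> 'b::{banach, second_countable_topology}"
  assumes "continuous_on UNIV f" "\<And>x. norm x > R \<Longrightarrow> f x = 0"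
  shows "integrable lborel f"
proof -
  have "(\<lambda>x. indicator (cball 0 R) x *\<^sub>R f x) = f"
    using assms(2) by (force simp: indicator_def fun_eq_iff)
  moreover have "integrable lborel (\<lambda>x. indicator (cball 0 R) x *\<^sub>R f x)"
    by (rule borel_integrable_compact) (auto intro: continuous_on_subset[OF assms(1)])
  ultimately show ?thesis by simp
qed

lemma bounded_compact_support:
  fixes f :: "real^3 \<Rightarrow> real"
  assumes "continuous_on UNIV f" "\<And>x. norm x > R \<Longrightarrow> f x = 0"
  obtains M where "M \<ge> 0" "\<And>x. \<bar>f x\<bar> \<le> M"
proof -
  have "compact (f ` cball 0 R)"
    by (rule compact_continuous_image) (auto intro: continuous_on_subset[OF assms(1)])
  then obtain M where M: "\<forall>y\<in>f ` cball 0 R. norm y \<le> M"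
    using compact_imp_bounded bounded_iff by metis
  have "\<bar>f x\<bar> \<le> \<bar>M\<bar>" for x
  proof (cases "norm x \<le> R")
    case True
    then have "norm (f x) \<le> M" using M by simp
    then show ?thesis by simp
  next
    case False
    then show ?thesis using assms(2)[of x] by simp
  qed
  then show ?thesis using that[of "\<bar>M\<bar>"] by simp
qed

lemma integral_affine:
  fixes f :: "real^3 \<Rightarrow> 'b::{banach, second_countable_topology}"
  assumes [measurable]: "f \<in> borel_measurable borel" and c: "c > 0"
  shows "(LINT x|lborel. f x) = c ^ 3 *\<^sub>R (LINT x|lborel. f (t + c *\<^sub>R x))"
proof -
  have "(LINT x|lborel. f x) = (LINT x|density (distr lborel borel (\<lambda>x. t + c *\<^sub>R x)) (\<lambda>_. \<bar>c\<bar>^DIM(real^3)). f x)"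
    using lborel_affine[of c t] c by simp
  also have "\<dots> = (LINT x|distr lborel borel (\<lambda>x. t + c *\<^sub>R x). c ^ 3 *\<^sub>R f x)"
    using c by (subst integral_density) auto
  also have "\<dots> = (LINT x|lborel. c ^ 3 *\<^sub>R f (t + c *\<^sub>R x))"
    by (rule integral_distr) auto
  finally show ?thesis by simp
qed

text \<open>The smooth functions of compact support. Vanishing outside a ball passes to products and
  derivatives without computing closures.\<close>

definition test :: "(real^3 \<Rightarrow> complex) \<Rightarrow> bool"
  where "test \<eta> \<longleftrightarrow> smooth \<eta> \<and> (\<exists>R. \<forall>x. norm x > R \<longrightarrow> \<eta> x = 0)"

lemma testD: "test \<eta> \<Longrightarrow> smooth \<eta>" by (simp add: test_def)

lemma test_mult: "smooth f \<Longrightarrow> test \<eta> \<Longrightarrow> test (\<lambda>x. f x * \<eta> x)"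
  unfolding test_def by (auto intro: smooth_mult)

lemma test_mult2: "test \<eta> \<Longrightarrow> smooth f \<Longrightarrow> test (\<lambda>x. \<eta> x * f x)"
  using test_mult[of f \<eta>] by (simp add: mult.commute)

lemma partial_eq_0_outside:
  assumes "\<And>x. norm x > R \<Longrightarrow> f x = 0" "norm x > R"
  shows "partial i f x = 0"
proof -
  have "open {x::real^3. norm x > R}" by (intro open_Collect_less continuous_intros)
  from partial_cong_open[OF this, of x f "\<lambda>x. 0"] assms show ?thesis by simp
qed

lemma test_partial: "test \<eta> \<Longrightarrow> test (partial i \<eta>)"
  unfolding test_def using smooth_partial partial_eq_0_outside by metis

lemma test_partial_funpow: "test \<eta> \<Longrightarrow> test ((partial i ^^ n) \<eta>)"
  by (induction n) (auto simp: test_partial)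

lemma test_mderiv: "test \<eta> \<Longrightarrow> test (mderiv \<alpha> \<eta>)"
  by (simp add: mderiv_def test_partial_funpow)

lemma test_integrable: "test \<eta> \<Longrightarrow> integrable lborel \<eta>"
  using integrable_compact_support smooth_continuous unfolding test_def by metis

lemma test_weighted_bounded:
  assumes "test \<eta>"
  shows "bdd_above (range (\<lambda>x. (1 + norm x) ^ N * norm (\<eta> x)))"
proof -
  obtain R where R: "\<And>x. norm x > R \<Longrightarrow> \<eta> x = 0" using assms by (auto simp: test_def)
  have "continuous_on UNIV (\<lambda>x. (1 + norm x) ^ N * norm (\<eta> x))"
    using smooth_continuous[OF testD[OF assms]] by (intro continuous_intros)
  then obtain M where M: "\<And>x. \<bar>(1 + norm x) ^ N * norm (\<eta> x)\<bar> \<le> M"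
    by (rule bounded_compact_support[of _ R]) (use R in auto)
  then have "(1 + norm x) ^ N * norm (\<eta> x) \<le> M" for x
    using abs_ge_self order_trans by blast
  then show ?thesis by (rule bdd_aboveI2)
qed

lemma test_schwartz: "test \<eta> \<Longrightarrow> \<eta> \<in> schwartz"
  by (simp add: schwartz_def testD test_weighted_bounded test_mderiv)

lemma test_finite_moment: assumes "test \<eta>" shows "finite_moment k \<eta>"
proof -
  obtain R where "\<And>x. norm x > R \<Longrightarrow> \<eta> x = 0" using assms by (auto simp: test_def)
  then have "integrable lborel (\<lambda>x. (1 + norm x) ^ k * norm (\<eta> x))"
    using smooth_continuous[OF testD[OF assms]]
    by (intro integrable_compact_support[of _ R] continuous_intros) auto
  then show ?thesis
    using smooth_continuous[OF testD[OF assms]]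
    by (simp add: finite_moment_def borel_measurable_continuous_onI)
qed

lemma smooth_coord: "smooth (\<lambda>x. of_real (x $ i))"
  unfolding smooth_def by (intro allI C_k_linear bounded_linear_compose[OF bounded_linear_of_real bounded_linear_vec_nth])

lemma smooth_power: "smooth f \<Longrightarrow> smooth (\<lambda>x. f x ^ n)"
  by (induction n) (auto intro: smooth_mult)

lemma smooth_imon: "smooth (imon \<alpha>)"
  unfolding imon_def by (intro smooth_mult smooth_power smooth_coord smooth_const)

lemma smooth_cis: "smooth (\<lambda>y. cis (y \<bullet> \<xi>))"
  by (simp add: smooth_def C_k_cis)

section \<open>Integration by parts and the decay of transforms\<close>

lemma has_vector_derivative_line:
  fixes f :: "real^3 \<Rightarrow> complex"
  assumes "f differentiable (at (y + t *\<^sub>R axis i 1))"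
  shows "((\<lambda>t. f (y + t *\<^sub>R axis i 1)) has_vector_derivative partial i f (y + t *\<^sub>R axis i 1)) (at t)"
proof -
  let ?F = "frechet_derivative f (at (y + t *\<^sub>R axis i 1))"
  have 1: "((\<lambda>t. y + t *\<^sub>R axis i 1) has_derivative (\<lambda>h. h *\<^sub>R axis i 1)) (at t)"
    by (auto intro!: derivative_eq_intros)
  have 2: "(f has_derivative ?F) (at (y + t *\<^sub>R axis i 1))"
    using assms frechet_derivative_works by blast
  have "?F (h *\<^sub>R axis i 1) = h *\<^sub>R partial i f (y + t *\<^sub>R axis i 1)" for h
    using linear_scale[OF linear_frechet_derivative[OF assms]] by (simp add: partial_def)
  then show ?thesis
    using has_derivative_compose[OF 1 2] by (simp add: has_vector_derivative_def)
qed

text \<open>By translation invariance of Lebesgue measure every difference quotient in direction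
  \<open>i\<close> integrates to zero, and dominated convergence carries this to the
  derivative.\<close>

lemma integral_partial_eq_0:
  assumes "test \<eta>" shows "(LINT x|lborel. partial i \<eta> x) = 0"
proof -
  obtain R where R: "\<And>x. norm x > R \<Longrightarrow> \<eta> x = 0" using assms by (auto simp: test_def)
  have sm: "smooth \<eta>" using assms by (rule testD)
  have [measurable]: "\<eta> \<in> borel_measurable borel" "partial i \<eta> \<in> borel_measurable borel"
    using smooth_continuous[OF sm] smooth_continuous[OF smooth_partial[OF sm]] by (auto intro: borel_measurable_continuous_onI)
  have "continuous_on UNIV (\<lambda>x. norm (partial i \<eta> x))"
    using smooth_continuous[OF smooth_partial[OF sm]] by (intro continuous_intros)
  then obtain M where M: "M \<ge> 0" "\<And>x. \<bar>norm (partial i \<eta> x)\<bar> \<le> M"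
    by (rule bounded_compact_support[of _ R]) (use R partial_eq_0_outside[of R \<eta>] in auto)
  define t where "t n = inverse (real (Suc n))" for n
  \<comment> \<open>Steps of length at most 1 keep all the quotients supported in the fixed ball of
    radius \<open>R + 1\<close>.\<close>
  have t: "t n > 0" "t n \<le> 1" for n by (auto simp: t_def field_simps)
  define f where "f n y = (\<eta> (y + t n *\<^sub>R axis i 1) - \<eta> y) /\<^sub>R t n" for n y
  have [measurable]: "f n \<in> borel_measurable borel" for n unfolding f_def by measurable
  have line: "((\<lambda>s. \<eta> (y + s *\<^sub>R axis i 1)) has_vector_derivative partial i \<eta> (y + s *\<^sub>R axis i 1)) (at s)" for y s
    by (rule has_vector_derivative_line[OF smooth_differentiable[OF sm]])
  have out: "\<eta> (y + t n *\<^sub>R axis i 1) = 0" if "norm y > R + 1" for y n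
  proof -
    have "norm (y + t n *\<^sub>R axis i 1) \<ge> norm y - norm (t n *\<^sub>R axis i (1::real) :: real^3)"
      by (rule norm_diff_ineq)
    with that t[of n] have "norm (y + t n *\<^sub>R axis i 1) > R" by (simp add: norm_axis_1)
    then show ?thesis by (rule R)
  qed
  have bound: "norm (f n y) \<le> M * indicator (cball 0 (R + 1)) y" for n y
  proof (cases "norm y \<le> R + 1")
    case True
    \<comment> \<open>The mean value inequality on the line through \<open>y\<close> bounds the
      quotients by the supremum of the derivative, uniformly in \<open>n\<close>.\<close>
    have "norm (\<eta> (y + t n *\<^sub>R axis i 1) - \<eta> (y + 0 *\<^sub>R axis i 1)) \<le> M * norm (t n - 0)"
    proof (rule differentiable_bound[where S = UNIV])
      show "((\<lambda>s. \<eta> (y + s *\<^sub>R axis i 1)) has_derivative (\<lambda>h. h *\<^sub>R partial i \<eta> (y + s *\<^sub>R axis i 1))) (at s within UNIV)" for s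
        using line by (simp add: has_vector_derivative_def)
      show "onorm (\<lambda>h. h *\<^sub>R partial i \<eta> (y + s *\<^sub>R axis i 1)) \<le> M" for s
        using mult_left_mono[OF M(2)] by (intro onorm_le) (simp add: mult.commute[of M])
    qed auto
    then have "norm (\<eta> (y + t n *\<^sub>R axis i 1) - \<eta> y) / t n \<le> M"
      using t[of n] by (simp add: divide_le_eq)
    then show ?thesis using t[of n] True by (simp add: f_def divide_inverse mult.commute)
  next
    case False
    then show ?thesis using R[of y] out[of y n] by (simp add: f_def)
  qed
  have "(\<lambda>n. LINT y|lborel. f n y) \<longlonglongrightarrow> (LINT y|lborel. partial i \<eta> y)"
  proof (rule integral_dominated_convergence)
    show "integrable lborel (\<lambda>y::real^3. M * indicator (cball 0 (R + 1)) y)"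
      by (intro integrable_mult_right integrable_real_indicator emeasure_lborel_cball_finite) auto
    show "AE y in lborel. (\<lambda>n. f n y) \<longlonglongrightarrow> partial i \<eta> y"
    proof (rule AE_I2)
      fix y
      have L: "(\<lambda>h. norm (\<eta> (y + h *\<^sub>R axis i 1) - \<eta> y - h *\<^sub>R partial i \<eta> y) / norm h) \<midarrow>0\<rightarrow> 0"
        using line[of y 0] by (simp add: has_vector_derivative_def has_derivative_at)
      have "t \<longlonglongrightarrow> 0" unfolding t_def by (rule LIMSEQ_inverse_real_of_nat)
      moreover have "t n \<in> UNIV - {0}" for n using t(1)[of n] by simp
      ultimately have "(\<lambda>n. norm (\<eta> (y + t n *\<^sub>R axis i 1) - \<eta> y - t n *\<^sub>R partial i \<eta> y) / norm (t n)) \<longlonglongrightarrow> 0"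
        using L[unfolded tendsto_at_iff_sequentially, rule_format, of t] by (simp only: o_def)
      moreover have "norm (\<eta> (y + t n *\<^sub>R axis i 1) - \<eta> y - t n *\<^sub>R partial i \<eta> y) / norm (t n) = norm (f n y - partial i \<eta> y)" for n
      proof -
        have "f n y - partial i \<eta> y = (\<eta> (y + t n *\<^sub>R axis i 1) - \<eta> y - t n *\<^sub>R partial i \<eta> y) /\<^sub>R t n"
          using t[of n] by (simp add: f_def scaleR_diff_right)
        then show ?thesis by (simp add: divide_inverse mult.commute)
      qed
      ultimately show "(\<lambda>n. f n y) \<longlonglongrightarrow> partial i \<eta> y"
        by (simp add: tendsto_norm_zero_iff LIM_zero_iff)
    qed
  qed (use bound in auto)
  moreover have "(LINT y|lborel. f n y) = 0" for n
  proof -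
    have "(LINT y|lborel. \<eta> (y + t n *\<^sub>R axis i 1)) = (LINT y|lborel. \<eta> y)"
      using integral_affine[of \<eta> 1 "t n *\<^sub>R axis i 1"] by (simp add: add.commute)
    moreover have "integrable lborel (\<lambda>y. \<eta> (y + t n *\<^sub>R axis i 1))"
      using smooth_continuous[OF smooth_affine[OF sm, of 1 "t n *\<^sub>R axis i 1"]] out
      by (intro integrable_compact_support[of _ "R + 1"]) auto
    ultimately show ?thesis
      unfolding f_def using test_integrable[OF assms] by simp
  qed
  ultimately show ?thesis by (simp add: LIMSEQ_const_iff)
qed

text \<open>Integration by parts: the derivative of the plane wave times \<eta> integrates to zero,
  and the product rule splits it into the two sides of the identity.\<close>

lemma ft_partial:
  assumes "test \<eta>"
  shows "ft (partial i \<eta>) \<xi> = - (\<i> * of_real (\<xi> $ i)) * ft \<eta> \<xi>"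
proof -
  let ?e = "\<lambda>y. cis (y \<bullet> \<xi>)"
  have t: "test (\<lambda>y. ?e y * \<eta> y)" using smooth_cis assms by (rule test_mult)
  have p: "partial i (\<lambda>y. ?e y * \<eta> y) y = \<i> * of_real (\<xi> $ i) * (?e y * \<eta> y) + ?e y * partial i \<eta> y" for y
    using partial_mult[OF smooth_differentiable[OF smooth_cis[of \<xi>]] smooth_differentiable[OF testD[OF assms]], of i y]
    by (simp add: partial_cis)
  have "test (\<lambda>y. ?e y * partial i \<eta> y)" using smooth_cis test_partial[OF assms] by (rule test_mult)
  then have "0 = \<i> * of_real (\<xi> $ i) * (LINT y|lborel. ?e y * \<eta> y) + (LINT y|lborel. ?e y * partial i \<eta> y)"
    using integral_partial_eq_0[OF t, of i] t unfolding p by (simp add: test_integrable)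
  then show ?thesis by (simp add: ft_def inner_commute eq_neg_iff_add_eq_0 add.commute)
qed

lemma ft_partial_funpow:
  "test \<eta> \<Longrightarrow> ft ((partial i ^^ n) \<eta>) \<xi> = (- (\<i> * of_real (\<xi> $ i))) ^ n * ft \<eta> \<xi>"
  by (induction n) (simp_all add: ft_partial test_partial_funpow mult_ac)

text \<open>Pure powers of the coordinates control the full weight, so decay of a transform follows
  from unmixed derivatives. The 4 counts the summands 1 and the three coordinates, each at most
  their maximum \<open>t\<close>.\<close>

lemma one_plus_norm_power_le:
  fixes \<xi> :: "real^3"
  shows "(1 + norm \<xi>) ^ N \<le> 4 ^ N * (1 + \<bar>\<xi> $ 1\<bar> ^ N + \<bar>\<xi> $ 2\<bar> ^ N + \<bar>\<xi> $ 3\<bar> ^ N)"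
proof -
  define t where "t = max 1 (max \<bar>\<xi> $ 1\<bar> (max \<bar>\<xi> $ 2\<bar> \<bar>\<xi> $ 3\<bar>))"
  have "norm \<xi> \<le> \<bar>\<xi> $ 1\<bar> + \<bar>\<xi> $ 2\<bar> + \<bar>\<xi> $ 3\<bar>"
    using norm_le_l1_cart[of \<xi>] unfolding sum_3 .
  then have "1 + norm \<xi> \<le> 4 * t" by (auto simp: t_def)
  then have "(1 + norm \<xi>) ^ N \<le> 4 ^ N * t ^ N"
    using power_mono[of "1 + norm \<xi>" "4 * t" N] by (simp add: power_mult_distrib)
  also have "t ^ N \<le> 1 + \<bar>\<xi> $ 1\<bar> ^ N + \<bar>\<xi> $ 2\<bar> ^ N + \<bar>\<xi> $ 3\<bar> ^ N"
  proof -
    have "0 \<le> \<bar>\<xi> $ i\<bar> ^ N" for i by simp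
    note this[of 1] this[of 2] this[of 3]
    moreover have "t = 1 \<or> t = \<bar>\<xi> $ 1\<bar> \<or> t = \<bar>\<xi> $ 2\<bar> \<or> t = \<bar>\<xi> $ 3\<bar>"
      by (auto simp: t_def max_def)
    ultimately show ?thesis by (elim disjE) simp_all
  qed
  finally show ?thesis by simp
qed

text \<open>Smoothness becomes decay: the n-th power of a coordinate times the transform is bounded
  by the L^1 norm of the n-th derivative in that direction.\<close>

lemma ft_test_weighted_bounded:
  assumes "test \<eta>"
  obtains C where "\<And>\<xi>. (1 + norm \<xi>) ^ N * norm (ft \<eta> \<xi>) \<le> C"
proof -
  define A where "A i n = (LINT y|lborel. norm ((partial i ^^ n) \<eta> y))" for i n
  have A: "\<bar>\<xi> $ i\<bar> ^ n * norm (ft \<eta> \<xi>) \<le> A i n" for i n \<xi>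
    using norm_ft_le[OF test_integrable[OF test_partial_funpow[OF assms]], of n i \<xi>]
    unfolding A_def by (simp add: ft_partial_funpow[OF assms] norm_mult norm_power)
  have "(1 + norm \<xi>) ^ N * norm (ft \<eta> \<xi>) \<le> 4 ^ N * (A 1 0 + A 1 N + A 2 N + A 3 N)" for \<xi>
  proof -
    have "(1 + norm \<xi>) ^ N * norm (ft \<eta> \<xi>) \<le> 4 ^ N * (1 + \<bar>\<xi> $ 1\<bar> ^ N + \<bar>\<xi> $ 2\<bar> ^ N + \<bar>\<xi> $ 3\<bar> ^ N) * norm (ft \<eta> \<xi>)"
      by (rule mult_right_mono[OF one_plus_norm_power_le]) simp
    also have "\<dots> = 4 ^ N * (norm (ft \<eta> \<xi>) + \<bar>\<xi> $ 1\<bar> ^ N * norm (ft \<eta> \<xi>) + \<bar>\<xi> $ 2\<bar> ^ N * norm (ft \<eta> \<xi>) + \<bar>\<xi> $ 3\<bar> ^ N * norm (ft \<eta> \<xi>))"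
      by (simp only: distrib_left distrib_right mult.assoc mult_1)
    also have "\<dots> \<le> 4 ^ N * (A 1 0 + A 1 N + A 2 N + A 3 N)"
      using A[of \<xi> 1 0] by (intro mult_left_mono add_mono A) auto
    finally show ?thesis .
  qed
  then show ?thesis by (rule that)
qed

text \<open>\<open>represents\<close> makes a statement on Schwartz functions only, so a transform
  must be known to be one before a distribution can be paired with it. Its derivatives are again
  transforms of test functions, namely of \<open>imon \<alpha>\<close> times \<eta>.\<close>

lemma ft_test_schwartz:
  assumes "test \<eta>" shows "ft \<eta> \<in> schwartz"
  unfolding schwartz_def
proof (intro CollectI conjI allI)
  show "smooth (ft \<eta>)"
    using assms by (simp add: smooth_def C_k_ft test_finite_moment)
  fix \<alpha> N
  have "test (\<lambda>\<xi>. imon \<alpha> \<xi> * \<eta> \<xi>)" using smooth_imon assms by (rule test_mult)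
  then obtain C where "\<And>\<xi>. (1 + norm \<xi>) ^ N * norm (ft (\<lambda>\<xi>. imon \<alpha> \<xi> * \<eta> \<xi>) \<xi>) \<le> C"
    using ft_test_weighted_bounded by blast
  then show "bdd_above (range (\<lambda>x. (1 + norm x) ^ N * norm (mderiv \<alpha> (ft \<eta>) x)))"
    unfolding mderiv_ft[OF test_finite_moment[OF assms]] by (rule bdd_aboveI2)
qed

section \<open>Gaussians and Fourier inversion\<close>


definition gauss :: "real^3 \<Rightarrow> complex"
  where "gauss x = of_real (exp (- (x \<bullet> x) / 2))"

text \<open>Up to the factor \<open>sqrt (2 * pi)\<close> this is the characteristic function of the
  standard normal distribution.\<close>

lemma gauss_1D:
  shows "integrable lborel (\<lambda>x. cis (t * x) * of_real (exp (- x\<^sup>2 / 2)))"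
    and "(LINT x|lborel. cis (t * x) * of_real (exp (- x\<^sup>2 / 2))) = of_real (sqrt (2 * pi) * exp (- t\<^sup>2 / 2))"
proof -
  have e: "cis (t * x) * of_real (exp (- x\<^sup>2 / 2)) = sqrt (2 * pi) *\<^sub>R (std_normal_density x *\<^sub>R iexp (t * x))" for x
    by (simp add: std_normal_density_def cis_conv_exp scaleR_conv_of_real)
  have i: "integrable lborel (\<lambda>x. std_normal_density x *\<^sub>R iexp (t * x))"
  proof (rule Bochner_Integration.integrable_bound)
    show "integrable lborel std_normal_density"
      using integrable_normal_density[of 1 0] by simp
    show "(\<lambda>x. std_normal_density x *\<^sub>R iexp (t * x)) \<in> borel_measurable lborel"
    proof -
      have "continuous_on UNIV (\<lambda>x. std_normal_density x *\<^sub>R iexp (t * x))"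
        unfolding std_normal_density_def by (intro continuous_intros) auto
      then show ?thesis by (simp add: borel_measurable_continuous_onI)
    qed
  qed (auto simp: norm_exp_i_times)
  then show "integrable lborel (\<lambda>x. cis (t * x) * of_real (exp (- x\<^sup>2 / 2)))"
    unfolding e by (rule integrable_scaleR_right)
  have "char std_normal_distribution t = (LINT x|lborel. std_normal_density x *\<^sub>R iexp (t * x))"
    unfolding char_def
    by (rule integral_density) (auto intro!: borel_measurable_continuous_onI continuous_intros)
  then have "(LINT x|lborel. std_normal_density x *\<^sub>R iexp (t * x)) = of_real (exp (- t\<^sup>2 / 2))"
    unfolding char_std_normal_distribution by simp
  then show "(LINT x|lborel. cis (t * x) * of_real (exp (- x\<^sup>2 / 2))) = of_real (sqrt (2 * pi) * exp (- t\<^sup>2 / 2))"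
    unfolding e Bochner_Integration.integral_scaleR_right by (simp add: scaleR_conv_of_real)
qed

lemma measurable_gauss [measurable]: "gauss \<in> borel_measurable borel"
  unfolding gauss_def by measurable

text \<open>The point \<xi> has the form in which \<open>lborel\<close> is the image of a product of
  one-dimensional Lebesgue measures, so the Gaussian integral splits into factors.\<close>

lemma gauss_product:
  fixes f :: "real^3 \<Rightarrow> real"
  defines "\<xi> \<equiv> (\<Sum>b\<in>Basis. f b *\<^sub>R b)"
  shows "cis (a \<bullet> \<xi>) * gauss \<xi> = (\<Prod>b\<in>Basis. cis ((a \<bullet> b) * f b) * of_real (exp (- (f b)\<^sup>2 / 2)))"
proof -
  have c: "\<xi> \<bullet> b = f b" if "b \<in> Basis" for b using that by (simp add: \<xi>_def)
  have "a \<bullet> \<xi> = (\<Sum>b\<in>Basis. (a \<bullet> b) * f b)" by (subst euclidean_inner) (simp add: c)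
  moreover have "- (\<xi> \<bullet> \<xi>) / 2 = (\<Sum>b\<in>Basis. - (f b)\<^sup>2 / 2)"
    by (subst euclidean_inner) (simp add: c power2_eq_square sum_negf sum_divide_distrib)
  ultimately show ?thesis
    by (simp add: gauss_def prod.distrib cis_conv_exp sum_distrib_left exp_sum flip: of_real_prod)
qed

lemma integrable_cis_gauss: "integrable lborel (\<lambda>\<xi>. cis (a \<bullet> \<xi>) * gauss \<xi>)"
  and integral_cis_gauss: "(LINT \<xi>|lborel. cis (a \<bullet> \<xi>) * gauss \<xi>) = of_real (sqrt (2 * pi) ^ 3) * gauss a"
proof -
  interpret product_sigma_finite "\<lambda>_::real^3. lborel :: real measure"
    by (simp add: product_sigma_finite_def sigma_finite_lborel)
  let ?g = "\<lambda>b x. cis ((a \<bullet> b) * x) * complex_of_real (exp (- x\<^sup>2 / 2))"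
  have m: "(\<lambda>\<xi>. cis (a \<bullet> \<xi>) * gauss \<xi>) \<in> borel_measurable borel" by measurable
  have T: "(\<lambda>f. \<Sum>b\<in>Basis. f b *\<^sub>R b) \<in> (\<Pi>\<^sub>M b\<in>Basis. lborel) \<rightarrow>\<^sub>M (borel :: (real^3) measure)"
    by measurable
  have L: "(lborel :: (real^3) measure) = distr (\<Pi>\<^sub>M b\<in>Basis. lborel) borel (\<lambda>f. \<Sum>b\<in>Basis. f b *\<^sub>R b)"
    by (rule lborel_eq)
  show "integrable lborel (\<lambda>\<xi>. cis (a \<bullet> \<xi>) * gauss \<xi>)"
    unfolding L integrable_distr_eq[OF T m] gauss_product
    by (rule product_integrable_prod[OF finite_Basis gauss_1D(1)])
  have "(LINT \<xi>|lborel. cis (a \<bullet> \<xi>) * gauss \<xi>) = (\<Prod>b\<in>Basis. LINT x|lborel. ?g b x)"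
    unfolding L integral_distr[OF T m] gauss_product
    by (rule product_integral_prod[OF finite_Basis gauss_1D(1)])
  also have "\<dots> = (\<Prod>b\<in>Basis. of_real (sqrt (2 * pi)) * of_real (exp (- (a \<bullet> b)\<^sup>2 / 2)))"
    by (intro prod.cong refl) (simp only: gauss_1D(2) of_real_mult)
  also have "\<dots> = of_real (sqrt (2 * pi) ^ 3) * (\<Prod>b\<in>Basis. of_real (exp (- (a \<bullet> b)\<^sup>2 / 2)))"
    by (simp add: prod.distrib)
  \<comment> \<open>The plane wave at frequency 0 is 1, so the product formula recombines the
    Gaussian itself.\<close>
  also have "(\<Prod>b\<in>Basis. complex_of_real (exp (- (a \<bullet> b)\<^sup>2 / 2))) = gauss a"
    using gauss_product[of 0 "\<lambda>b. a \<bullet> b"] by (simp add: euclidean_representation)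
  finally show "(LINT \<xi>|lborel. cis (a \<bullet> \<xi>) * gauss \<xi>) = of_real (sqrt (2 * pi) ^ 3) * gauss a" .
qed

lemma integrable_gauss: "integrable lborel gauss"
  using integrable_cis_gauss[of 0] by simp

lemma norm_gauss_le: "norm (gauss x) \<le> 1"
  by (simp add: gauss_def)

text \<open>As a function of \<open>a\<close> the right-hand side has integral (2 pi)^3 and
  concentrates at 0 as \<epsilon> tends to 0: the approximate identity behind the inversion
  formula.\<close>

lemma gauss_scaled:
  assumes "\<epsilon> > 0"
  shows "integrable lborel (\<lambda>\<xi>. gauss (\<epsilon> *\<^sub>R \<xi>))"
    and "(LINT \<xi>|lborel. cis (a \<bullet> \<xi>) * gauss (\<epsilon> *\<^sub>R \<xi>)) =
      of_real (sqrt (2 * pi) ^ 3 / \<epsilon> ^ 3) * gauss (a /\<^sub>R \<epsilon>)"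
proof -
  show "integrable lborel (\<lambda>\<xi>. gauss (\<epsilon> *\<^sub>R \<xi>))"
  proof -
    have "integrable (density (distr lborel borel (\<lambda>x. 0 + \<epsilon> *\<^sub>R x)) (\<lambda>_. ennreal (\<bar>\<epsilon>\<bar>^DIM(real^3)))) gauss"
      using integrable_gauss assms by (subst lborel_affine[of \<epsilon> "0 :: real^3", symmetric]) simp_all
    then have "integrable lborel (\<lambda>\<xi>. \<epsilon> ^ 3 *\<^sub>R gauss (\<epsilon> *\<^sub>R \<xi>))"
      using assms by (simp add: integrable_density integrable_distr_eq)
    from integrable_scaleR_right[OF this, of "inverse (\<epsilon> ^ 3)"] show ?thesis
      using assms by simp
  qed
  have e: "(a /\<^sub>R \<epsilon>) \<bullet> (0 + \<epsilon> *\<^sub>R \<xi>) = a \<bullet> \<xi>" for \<xi> using assms by simp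
  have "(LINT \<xi>|lborel. cis ((a /\<^sub>R \<epsilon>) \<bullet> \<xi>) * gauss \<xi>) =
      \<epsilon> ^ 3 *\<^sub>R (LINT \<xi>|lborel. cis ((a /\<^sub>R \<epsilon>) \<bullet> (0 + \<epsilon> *\<^sub>R \<xi>)) * gauss (0 + \<epsilon> *\<^sub>R \<xi>))"
    by (rule integral_affine) (use assms in auto)
  then have "\<epsilon> ^ 3 *\<^sub>R (LINT \<xi>|lborel. cis (a \<bullet> \<xi>) * gauss (\<epsilon> *\<^sub>R \<xi>)) = of_real (sqrt (2 * pi) ^ 3) * gauss (a /\<^sub>R \<epsilon>)"
    unfolding e integral_cis_gauss by simp
  then show "(LINT \<xi>|lborel. cis (a \<bullet> \<xi>) * gauss (\<epsilon> *\<^sub>R \<xi>)) =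
      of_real (sqrt (2 * pi) ^ 3 / \<epsilon> ^ 3) * gauss (a /\<^sub>R \<epsilon>)"
    using assms by (simp add: scaleR_conv_of_real[where 'a = complex] field_simps)
qed

section \<open>The multiplication formula and Fourier inversion\<close>

lemma integrable_kernel_mult:
  fixes f g :: "real^3 \<Rightarrow> complex"
  assumes f: "integrable lborel f" and g: "integrable lborel g"
    and [measurable]: "case_prod k \<in> borel_measurable (borel \<Otimes>\<^sub>M borel)"
    and k: "\<And>x y. norm (k x y) \<le> 1"
  shows "integrable (lborel \<Otimes>\<^sub>M lborel) (\<lambda>(x, y). k x y * (f x * g y))"
proof (rule Bochner_Integration.integrable_bound)
  have [measurable]: "f \<in> borel_measurable borel" "g \<in> borel_measurable borel"
    using f g by (auto dest: borel_measurable_integrable)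
  show "integrable (lborel \<Otimes>\<^sub>M lborel) (\<lambda>p. f (fst p) * g (snd p))"
    by (rule lborel_pair.Fubini_integrable) (use f g in \<open>auto simp: norm_mult\<close>)
  show "(\<lambda>(x, y). k x y * (f x * g y)) \<in> borel_measurable (lborel \<Otimes>\<^sub>M lborel)"
    by measurable
  show "AE p in lborel \<Otimes>\<^sub>M lborel. norm (case p of (x, y) \<Rightarrow> k x y * (f x * g y)) \<le> norm (f (fst p) * g (snd p))"
    using k mult_right_mono[OF k, of "norm (f x * g y)" for x y]
    by (intro AE_I2) (auto simp: norm_mult)
qed

lemma integral_swap_kernel:
  fixes f g :: "real^3 \<Rightarrow> complex"
  assumes f: "integrable lborel f" and g: "integrable lborel g"
    and k: "case_prod k \<in> borel_measurable (borel \<Otimes>\<^sub>M borel)" "\<And>x y. norm (k x y) \<le> 1"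
  shows "(LINT x|lborel. f x * (LINT y|lborel. k x y * g y)) = (LINT y|lborel. g y * (LINT x|lborel. k x y * f x))"
proof -
  have "(LINT y|lborel. LINT x|lborel. k x y * (f x * g y)) = (LINT x|lborel. LINT y|lborel. k x y * (f x * g y))"
    by (rule lborel_pair.Fubini_integral) (rule integrable_kernel_mult[OF assms])
  moreover have "(LINT x|lborel. k x y * (f x * g y)) = g y * (LINT x|lborel. k x y * f x)" for y
    by (subst integral_mult_right_zero[symmetric]) (simp add: mult_ac)
  moreover have "(LINT y|lborel. k x y * (f x * g y)) = f x * (LINT y|lborel. k x y * g y)" for x
    by (subst integral_mult_right_zero[symmetric]) (simp add: mult_ac)
  ultimately show ?thesis by simp
qed

lemma measurable_cis_kernel: "(\<lambda>(x :: real^3, y). cis (x \<bullet> y)) \<in> borel_measurable (borel \<Otimes>\<^sub>M borel)"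
  by measurable

text \<open>The multiplication formula: Fubini for the bounded kernel
  \<open>cis (x \<bullet> y)\<close>, which is symmetric in its two arguments.\<close>

lemma integral_ft_swap:
  assumes "integrable lborel f" "integrable lborel g"
  shows "(LINT x|lborel. f x * ft g x) = (LINT y|lborel. g y * ft f y)"
  using integral_swap_kernel[OF assms, of "\<lambda>x y. cis (x \<bullet> y)"] measurable_cis_kernel
  by (simp add: ft_def inner_commute)

text \<open>A Gaussian factor is inserted under the integral and its width is sent to infinity. One
  evaluation of the limit removes the factor, as the transform is integrable; the other moves the
  transform onto the Gaussian and meets an approximate identity at \<open>x\<close>. The bound
  \<open>B\<close> dominates in the latter.\<close>

lemma ft_inversion:
  assumes c: "continuous_on UNIV \<eta>" and i: "integrable lborel \<eta>" and b: "\<And>x. norm (\<eta> x) \<le> B"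
    and f: "integrable lborel (ft \<eta>)"
  shows "(LINT \<xi>|lborel. cis (- (x \<bullet> \<xi>)) * ft \<eta> \<xi>) = of_real ((2 * pi) ^ 3) * \<eta> x"
proof -
  have [measurable]: "\<eta> \<in> borel_measurable borel" "ft \<eta> \<in> borel_measurable borel"
    using i f by (auto dest: borel_measurable_integrable)
  define \<kappa> where "\<kappa> = complex_of_real (sqrt (2 * pi) ^ 3)"
  define t where "t n = inverse (real (Suc n))" for n
  have t: "t n > 0" for n by (auto simp: t_def)
  have t0: "t \<longlonglongrightarrow> 0" unfolding t_def by (rule LIMSEQ_inverse_real_of_nat)
  define A where "A n = (LINT \<xi>|lborel. cis (- (x \<bullet> \<xi>)) * gauss (t n *\<^sub>R \<xi>) * ft \<eta> \<xi>)" for n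
  have A1: "A \<longlonglongrightarrow> (LINT \<xi>|lborel. cis (- (x \<bullet> \<xi>)) * ft \<eta> \<xi>)"
    unfolding A_def
  proof (rule integral_dominated_convergence)
    show "integrable lborel (\<lambda>\<xi>. norm (ft \<eta> \<xi>))" using f by simp
    show "AE \<xi> in lborel. (\<lambda>n. cis (- (x \<bullet> \<xi>)) * gauss (t n *\<^sub>R \<xi>) * ft \<eta> \<xi>) \<longlonglongrightarrow> cis (- (x \<bullet> \<xi>)) * ft \<eta> \<xi>"
    proof (rule AE_I2)
      fix \<xi>
      have "(\<lambda>n. cis (- (x \<bullet> \<xi>)) * gauss (t n *\<^sub>R \<xi>) * ft \<eta> \<xi>) \<longlonglongrightarrow>
          cis (- (x \<bullet> \<xi>)) * of_real (exp (- ((0 *\<^sub>R \<xi>) \<bullet> (0 *\<^sub>R \<xi>)) / 2)) * ft \<eta> \<xi>"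
        unfolding gauss_def by (intro tendsto_intros t0) auto
      then show "(\<lambda>n. cis (- (x \<bullet> \<xi>)) * gauss (t n *\<^sub>R \<xi>) * ft \<eta> \<xi>) \<longlonglongrightarrow> cis (- (x \<bullet> \<xi>)) * ft \<eta> \<xi>"
        by simp
    qed
    show "AE \<xi> in lborel. norm (cis (- (x \<bullet> \<xi>)) * gauss (t n *\<^sub>R \<xi>) * ft \<eta> \<xi>) \<le> norm (ft \<eta> \<xi>)" for n
      using mult_right_mono[OF norm_gauss_le, of "norm (ft \<eta> \<xi>)" for \<xi>]
      by (intro AE_I2) (simp add: norm_mult)
  qed measurable
  have A_eq: "A n = \<kappa> * (LINT z|lborel. \<eta> (x + t n *\<^sub>R z) * gauss z)" for n
  proof -
    have ig: "integrable lborel (\<lambda>\<xi>. cis (- (x \<bullet> \<xi>)) * gauss (t n *\<^sub>R \<xi>))"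
      using integrable_cis_mult[OF gauss_scaled(1)[OF t[of n]], of "- x"] by simp
    have "A n = (LINT \<xi>|lborel. (cis (- (x \<bullet> \<xi>)) * gauss (t n *\<^sub>R \<xi>)) * ft \<eta> \<xi>)"
      by (simp add: A_def)
    also have "\<dots> = (LINT y|lborel. \<eta> y * ft (\<lambda>\<xi>. cis (- (x \<bullet> \<xi>)) * gauss (t n *\<^sub>R \<xi>)) y)"
      by (rule integral_ft_swap[OF ig i])
    also have "\<dots> = (LINT y|lborel. \<eta> y * (of_real (sqrt (2 * pi) ^ 3 / t n ^ 3) * gauss ((y - x) /\<^sub>R t n)))"
    proof (intro Bochner_Integration.integral_cong refl)
      fix y
      have "ft (\<lambda>\<xi>. cis (- (x \<bullet> \<xi>)) * gauss (t n *\<^sub>R \<xi>)) y = (LINT \<xi>|lborel. cis ((y - x) \<bullet> \<xi>) * gauss (t n *\<^sub>R \<xi>))"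
        unfolding ft_def by (simp add: mult.assoc[symmetric] cis_mult inner_diff_left)
      then show "\<eta> y * ft (\<lambda>\<xi>. cis (- (x \<bullet> \<xi>)) * gauss (t n *\<^sub>R \<xi>)) y =
          \<eta> y * (of_real (sqrt (2 * pi) ^ 3 / t n ^ 3) * gauss ((y - x) /\<^sub>R t n))"
        using gauss_scaled(2)[OF t[of n]] by simp
    qed
    \<comment> \<open>Substituting y = x + t z freezes the Gaussian and moves the small parameter
      into the argument of the continuous function \<eta>.\<close>
    also have "\<dots> = t n ^ 3 *\<^sub>R (LINT z|lborel. \<eta> (x + t n *\<^sub>R z) * (of_real (sqrt (2 * pi) ^ 3 / t n ^ 3) * gauss ((x + t n *\<^sub>R z - x) /\<^sub>R t n)))"
      by (rule integral_affine) (use t in auto)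
    also have "\<dots> = t n ^ 3 *\<^sub>R (LINT z|lborel. of_real (sqrt (2 * pi) ^ 3 / t n ^ 3) * (\<eta> (x + t n *\<^sub>R z) * gauss z))"
      using t[of n] by (simp add: mult_ac)
    also have "\<dots> = \<kappa> * (LINT z|lborel. \<eta> (x + t n *\<^sub>R z) * gauss z)"
      unfolding \<kappa>_def integral_mult_right_zero using t[of n] by (simp add: scaleR_conv_of_real)
    finally show ?thesis .
  qed
  have "(\<lambda>n. LINT z|lborel. \<eta> (x + t n *\<^sub>R z) * gauss z) \<longlonglongrightarrow> (LINT z|lborel. \<eta> x * gauss z)"
  proof (rule integral_dominated_convergence)
    show "integrable lborel (\<lambda>z. B * norm (gauss z))" using integrable_gauss by simp
    show "AE z in lborel. (\<lambda>n. \<eta> (x + t n *\<^sub>R z) * gauss z) \<longlonglongrightarrow> \<eta> x * gauss z"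
    proof (rule AE_I2)
      fix z
      have "(\<lambda>n. x + t n *\<^sub>R z) \<longlonglongrightarrow> x + 0 *\<^sub>R z" by (intro tendsto_intros t0)
      moreover have "isCont \<eta> x" using c by (simp add: continuous_on_eq_continuous_at)
      ultimately have "(\<lambda>n. \<eta> (x + t n *\<^sub>R z)) \<longlonglongrightarrow> \<eta> x"
        by (intro isCont_tendsto_compose[of x \<eta>]) simp_all
      then show "(\<lambda>n. \<eta> (x + t n *\<^sub>R z) * gauss z) \<longlonglongrightarrow> \<eta> x * gauss z" by (rule tendsto_mult_right)
    qed
    show "AE z in lborel. norm (\<eta> (x + t n *\<^sub>R z) * gauss z) \<le> B * norm (gauss z)" for n
      by (intro AE_I2) (simp add: norm_mult mult_right_mono b)
  qed measurable
  also have "(LINT z|lborel. \<eta> x * gauss z) = \<eta> x * \<kappa>"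
    using integral_cis_gauss[of 0] by (simp add: \<kappa>_def gauss_def)
  finally have "A \<longlonglongrightarrow> \<kappa> * (\<eta> x * \<kappa>)" unfolding A_eq[abs_def] by (rule tendsto_mult_left)
  with A1 have "(LINT \<xi>|lborel. cis (- (x \<bullet> \<xi>)) * ft \<eta> \<xi>) = \<kappa> * (\<eta> x * \<kappa>)" by (rule LIMSEQ_unique)
  also have "\<dots> = \<kappa> * \<kappa> * \<eta> x" by simp
  also have "\<kappa> * \<kappa> = of_real ((2 * pi) ^ 3)"
    unfolding \<kappa>_def by (simp add: power_mult_distrib[symmetric] of_real_mult[symmetric] del: of_real_mult of_real_power)
  finally show ?thesis .
qed

section \<open>Locally representing functions\<close>


text \<open>The weight is dominated by a sum of constants on dyadic balls. The ball of radius 2^k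
  has volume \<open>v\<close> times 8^k, so the integrals form a geometric series of ratio
  \<open>q\<close>, and \<open>q < 1\<close> is the condition \<open>t > 3/2\<close>.\<close>

lemma integrable_weight:
  assumes "t > 3/2"
  shows "integrable lborel (\<lambda>\<xi>::real^3. (1 + (norm \<xi>)\<^sup>2) powr (-t))"
proof (rule integrableI_bounded)
  show "(\<lambda>\<xi>::real^3. (1 + (norm \<xi>)\<^sup>2) powr (-t)) \<in> borel_measurable lborel" by measurable
  define v where "v = unit_ball_vol 3"
  define q where "q = 2 powr (3 - 2 * t)"
  have q: "0 \<le> q" "q < 1" using assms by (auto simp: q_def powr_less_one)
  have v: "0 \<le> v" by (simp add: v_def)
  have le_suminf: "f k \<le> (\<Sum>k. f k)" for f :: "nat \<Rightarrow> ennreal" and k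
    using sum_le_suminf[of f "{k}"] by simp
  let ?B = "\<lambda>k::nat. cball (0::real^3) (2 ^ k)"
  \<comment> \<open>For the least \<open>k\<close> with |\<xi>| \<le> 2^k and \<open>k > 0\<close>
    one has |\<xi>| > 2^(k-1), and 2^(-2t(k-1)) is \<open>?c k\<close>. For \<open>k = 0\<close> the
    weight is at most 1, hence at most 4^t.\<close>
  let ?c = "\<lambda>k::nat. 4 powr t * (2 powr (- 2 * t)) ^ k"
  have "(\<integral>\<^sup>+\<xi>. ennreal (norm ((1 + (norm \<xi>)\<^sup>2) powr (-t))) \<partial>(lborel :: (real^3) measure)) \<le>
      (\<integral>\<^sup>+\<xi>. (\<Sum>k. ennreal (?c k) * indicator (?B k) \<xi>) \<partial>lborel)"
  proof (rule nn_integral_mono)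
    fix \<xi> :: "real^3"
    obtain k0 where "norm \<xi> < 2 ^ k0" using real_arch_pow[of 2 "norm \<xi>"] by auto
    then have ex: "\<exists>k. norm \<xi> \<le> 2 ^ k" using less_imp_le by blast
    define k where "k = (LEAST k. norm \<xi> \<le> 2 ^ k)"
    have k: "norm \<xi> \<le> 2 ^ k" unfolding k_def using ex by (rule LeastI_ex)
    have "(1 + (norm \<xi>)\<^sup>2) powr (-t) \<le> ?c k"
    proof (cases k)
      case 0
      have "(1 + (norm \<xi>)\<^sup>2) powr (-t) \<le> 1 powr (-t)"
        using assms by (intro powr_mono2') auto
      also have "\<dots> \<le> 4 powr t" using assms by (simp add: ge_one_powr_ge_zero)
      finally show ?thesis using 0 by simp
    next
      case (Suc l)
      have "\<not> norm \<xi> \<le> 2 ^ l" using not_less_Least[of l "\<lambda>k. norm \<xi> \<le> 2 ^ k"] Suc by (simp add: k_def)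
      then have "(2 ^ l)\<^sup>2 \<le> (norm \<xi>)\<^sup>2" by (intro power_mono) auto
      then have "(2 ^ l)\<^sup>2 \<le> 1 + (norm \<xi>)\<^sup>2" by linarith
      then have "(1 + (norm \<xi>)\<^sup>2) powr (-t) \<le> ((2 ^ l)\<^sup>2) powr (-t)"
        using assms by (intro powr_mono2') auto
      also have "((2::real) ^ l)\<^sup>2 = 2 powr (2 * real l)"
        by (simp add: powr_realpow[symmetric] powr_powr power_mult[symmetric] mult.commute flip: powr_numeral)
      also have "\<dots> powr (-t) = 2 powr (2 * t) * (2 powr (- 2 * t * real (Suc l)))"
        by (simp add: powr_powr powr_add[symmetric] algebra_simps)
      also have "2 powr (- 2 * t * real (Suc l)) = (2 powr (- 2 * t)) ^ Suc l"
        using powr_realpow[of "2 powr (- 2 * t)" "Suc l"] by (simp only: powr_powr) simp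
      also have "2 powr (2 * t) = (4::real) powr t"
        using powr_powr[of 2 2 t] by simp
      finally show ?thesis using Suc by simp
    qed
    then have "ennreal (norm ((1 + (norm \<xi>)\<^sup>2) powr (-t))) \<le> ennreal (?c k) * indicator (?B k) \<xi>"
      using k by (simp add: ennreal_leI)
    also have "\<dots> \<le> (\<Sum>k. ennreal (?c k) * indicator (?B k) \<xi>)"
      by (rule le_suminf)
    finally show "ennreal (norm ((1 + (norm \<xi>)\<^sup>2) powr (-t))) \<le> (\<Sum>k. ennreal (?c k) * indicator (?B k) \<xi>)" .
  qed
  also have "\<dots> = (\<Sum>k. \<integral>\<^sup>+\<xi>. ennreal (?c k) * indicator (?B k) \<xi> \<partial>lborel)"
    by (rule nn_integral_suminf[where f = "\<lambda>k \<xi>. ennreal (?c k) * indicator (?B k) \<xi>"])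
      (intro borel_measurable_times_ennreal borel_measurable_const borel_measurable_indicator, simp)
  also have "\<dots> = (\<Sum>k. ennreal (?c k) * emeasure lborel (?B k))"
    by (intro suminf_cong nn_integral_cmult_indicator) simp
  also have "\<dots> = (\<Sum>k. ennreal (4 powr t * v * q ^ k))"
  proof (intro suminf_cong)
    fix k
    have "q = 2 powr (- 2 * t) * 2 powr 3" unfolding q_def by (subst powr_add[symmetric]) simp
    then have q3: "q = 2 powr (- 2 * t) * 2 ^ 3" by simp
    have "((2::real) ^ k) ^ 3 = (2 ^ 3) ^ k" by (simp only: power_mult[symmetric] mult.commute)
    then have "(2 powr (- 2 * t)) ^ k * (2 ^ k) ^ 3 = q ^ k"
      unfolding q3 power_mult_distrib by (rule arg_cong)
    then have "?c k * (v * (2 ^ k) ^ 3) = 4 powr t * v * q ^ k" by (metis mult.assoc mult.left_commute)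
    moreover have "emeasure lborel (?B k) = ennreal (v * (2 ^ k) ^ 3)" by (simp add: emeasure_cball v_def)
    ultimately show "ennreal (?c k) * emeasure lborel (?B k) = ennreal (4 powr t * v * q ^ k)"
      using v by (simp only: ennreal_mult[symmetric] powr_ge_zero zero_le_power mult_nonneg_nonneg zero_le_numeral)
  qed
  also have "\<dots> = ennreal (\<Sum>k. 4 powr t * v * q ^ k)"
    using q v by (intro suminf_ennreal2) (auto intro: summable_mult summable_geometric)
  also have "\<dots> < \<infinity>" by simp
  finally show "(\<integral>\<^sup>+\<xi>. ennreal (norm ((1 + (norm \<xi>)\<^sup>2) powr (-t))) \<partial>(lborel :: (real^3) measure)) < \<infinity>" .
qed

text \<open>Cauchy--Schwarz enters as $2ab \le L a^2 + b^2/L$: every bound $L$ may be used, and no square root of an integral occurs.\<close>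

lemma moment_bound:
  assumes "s > 3/2 + real m"
  obtains C where "C \<ge> 0"
    "\<And>g L. g \<in> borel_measurable borel \<Longrightarrow> L > 0 \<Longrightarrow>
      (\<integral>\<^sup>+ \<xi>. ennreal ((1 + (norm \<xi>)\<^sup>2) powr s * (norm (g \<xi> :: complex))\<^sup>2) \<partial>lborel) \<le> ennreal (L\<^sup>2) \<Longrightarrow>
      finite_moment m g \<and> (LINT \<xi>|lborel. (1 + norm (\<xi>::real^3)) ^ m * norm (g \<xi>)) \<le> C * L"
proof
  \<comment> \<open>Up to the constant 2^m this dominates the squared moment weight divided by the
    H^s weight; it is integrable because s - m > 3/2.\<close>
  define W where "W \<xi> = (1 + (norm \<xi>)\<^sup>2) powr (real m - s)" for \<xi> :: "real^3"
  have W: "integrable lborel W"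
    using integrable_weight[of "s - real m"] assms by (simp add: W_def[abs_def])
  have W0: "W \<xi> \<ge> 0" for \<xi> by (simp add: W_def)
  \<comment> \<open>The division by 2 is that of 2ab \<le> L a^2 + b^2/L, the factor 2^m comes from
    (1 + r)^2 \<le> 2 (1 + r^2), and the summand 1 from the integral of \<open>?b\<close>, at most
    L^2, divided by L.\<close>
  let ?C = "(2 ^ m * (LINT \<xi>|lborel. W \<xi>) + 1) / 2"
  show "0 \<le> ?C" using W0 by (simp add: Bochner_Integration.integral_nonneg)
  fix g :: "real^3 \<Rightarrow> complex" and L :: real
  assume g [measurable]: "g \<in> borel_measurable borel" and L: "L > 0"
  let ?b = "\<lambda>\<xi>. (1 + (norm \<xi>)\<^sup>2) powr s * (norm (g \<xi>))\<^sup>2"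
  assume I: "(\<integral>\<^sup>+ \<xi>. ennreal (?b \<xi>) \<partial>lborel) \<le> ennreal (L\<^sup>2)"
  have ib: "integrable lborel ?b"
  proof (rule integrableI_bounded)
    show "(\<integral>\<^sup>+ \<xi>. ennreal (norm (?b \<xi>)) \<partial>lborel) < \<infinity>"
      using I le_less_trans[OF _ ennreal_less_top] by simp
  qed measurable
  have Ib: "(LINT \<xi>|lborel. ?b \<xi>) \<le> L\<^sup>2"
    using I nn_integral_eq_integral[OF ib] by (simp add: ennreal_le_iff)
  have pt: "(1 + norm \<xi>) ^ m * norm (g \<xi>) \<le> (L * 2 ^ m * W \<xi> + ?b \<xi> / L) / 2" for \<xi>
  proof -
    let ?q = "1 + (norm \<xi>)\<^sup>2"
    have q: "?q > 0" by (simp add: add_pos_nonneg)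
    define a where "a = (1 + norm \<xi>) ^ m * ?q powr (- s / 2)"
    define b where "b = ?q powr (s / 2) * norm (g \<xi>)"
    have ab: "(1 + norm \<xi>) ^ m * norm (g \<xi>) = a * b"
      unfolding a_def b_def using q by (simp add: powr_add[symmetric])
    have b2: "b\<^sup>2 = ?b \<xi>"
      unfolding b_def using q by (simp add: power_mult_distrib powr_power)
    have "(1 + norm \<xi>)\<^sup>2 \<le> 2 * ?q"
      using sum_squares_bound[of 1 "norm \<xi>"] by (simp add: power2_eq_square algebra_simps)
    then have "((1 + norm \<xi>)\<^sup>2) ^ m \<le> (2 * ?q) ^ m" by (intro power_mono) auto
    then have "((1 + norm \<xi>) ^ m)\<^sup>2 \<le> 2 ^ m * ?q ^ m"
      by (simp only: power_mult_distrib power_mult[symmetric] mult.commute[of 2 m])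
    then have "a\<^sup>2 \<le> 2 ^ m * ?q ^ m * ?q powr (- s)"
      unfolding a_def using q by (simp add: power_mult_distrib powr_power mult_right_mono)
    also have "\<dots> = 2 ^ m * W \<xi>"
      unfolding W_def using q by (simp add: powr_realpow[symmetric] powr_add[symmetric])
    finally have a2: "a\<^sup>2 \<le> 2 ^ m * W \<xi>" .
    have "0 \<le> (L * a - b)\<^sup>2" by simp
    then have "2 * (a * b) * L \<le> L\<^sup>2 * a\<^sup>2 + b\<^sup>2" by (simp add: power2_eq_square algebra_simps)
    also have "\<dots> \<le> L\<^sup>2 * (2 ^ m * W \<xi>) + b\<^sup>2" using a2 by (simp add: mult_left_mono)
    finally have "a * b \<le> (L * (2 ^ m * W \<xi>) + b\<^sup>2 / L) / 2"
      using L by (simp add: field_simps power2_eq_square)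
    then show ?thesis unfolding ab b2 by (simp add: mult_ac)
  qed
  have ir: "integrable lborel (\<lambda>\<xi>. (L * 2 ^ m * W \<xi> + ?b \<xi> / L) / 2)" using W ib by simp
  have il: "integrable lborel (\<lambda>\<xi>. (1 + norm \<xi>) ^ m * norm (g \<xi>))"
  proof (rule Bochner_Integration.integrable_bound[OF ir])
    show "AE \<xi> in lborel. norm ((1 + norm \<xi>) ^ m * norm (g \<xi>)) \<le> norm ((L * 2 ^ m * W \<xi> + ?b \<xi> / L) / 2)"
    proof (rule AE_I2)
      fix \<xi>
      have "norm ((1 + norm \<xi>) ^ m * norm (g \<xi>)) = (1 + norm \<xi>) ^ m * norm (g \<xi>)" by simp
      also note pt[of \<xi>]
      finally show "norm ((1 + norm \<xi>) ^ m * norm (g \<xi>)) \<le> norm ((L * 2 ^ m * W \<xi> + ?b \<xi> / L) / 2)" by simp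
    qed
  qed measurable
  have "(LINT \<xi>|lborel. (1 + norm \<xi>) ^ m * norm (g \<xi>)) \<le> (LINT \<xi>|lborel. (L * 2 ^ m * W \<xi> + ?b \<xi> / L) / 2)"
    by (rule integral_mono[OF il ir pt])
  also have "\<dots> = (L * 2 ^ m * (LINT \<xi>|lborel. W \<xi>) + (LINT \<xi>|lborel. ?b \<xi>) / L) / 2"
    using W ib by simp
  also have "\<dots> \<le> (L * 2 ^ m * (LINT \<xi>|lborel. W \<xi>) + L\<^sup>2 / L) / 2"
    using Ib L by (simp add: divide_right_mono)
  also have "\<dots> = ?C * L" using L by (simp add: field_simps power2_eq_square)
  finally show "finite_moment m g \<and> (LINT \<xi>|lborel. (1 + norm \<xi>) ^ m * norm (g \<xi>)) \<le> ?C * L"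
    using il by (simp add: finite_moment_def)
qed

lemma norm_mderiv_ft_le:
  assumes "finite_moment m g" "order_mi \<alpha> \<le> m"
  shows "norm (mderiv \<alpha> (ft g) x) \<le> (LINT \<xi>|lborel. (1 + norm \<xi>) ^ m * norm (g \<xi>))"
proof -
  have fm: "finite_moment (order_mi \<alpha>) g"
    using finite_moment_mono[of "m - order_mi \<alpha>" "order_mi \<alpha>" g] assms by simp
  then have i: "integrable lborel (\<lambda>\<xi>. imon \<alpha> \<xi> * g \<xi>)"
    using finite_moment_imon[of \<alpha> 0 g] by (simp add: finite_moment_0)
  have "norm (imon \<alpha> \<xi>) \<le> (1 + norm \<xi>) ^ m" for \<xi>
  proof -
    have "norm (imon \<alpha> \<xi>) \<le> norm \<xi> ^ order_mi \<alpha>" by (rule norm_imon_le)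
    also have "\<dots> \<le> (1 + norm \<xi>) ^ order_mi \<alpha>" by (intro power_mono) auto
    also have "\<dots> \<le> (1 + norm \<xi>) ^ m" using assms by (intro power_increasing) auto
    finally show ?thesis .
  qed
  then have "norm (imon \<alpha> \<xi> * g \<xi>) \<le> (1 + norm \<xi>) ^ m * norm (g \<xi>)" for \<xi>
    by (simp add: norm_mult mult_right_mono)
  then have "(LINT \<xi>|lborel. norm (imon \<alpha> \<xi> * g \<xi>)) \<le> (LINT \<xi>|lborel. (1 + norm \<xi>) ^ m * norm (g \<xi>))"
    using i assms by (intro integral_mono) (auto simp: finite_moment_def)
  with norm_ft_le[OF i, of x] show ?thesis unfolding mderiv_ft[OF fm] by linarith
qed

text \<open>The inverse transform in the normalisation that matches \<open>fourier\<close>.\<close>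

definition ift :: "(real^3 \<Rightarrow> complex) \<Rightarrow> real^3 \<Rightarrow> complex"
  where "ift g x = (2 * pi) powr (-3/2) *\<^sub>R ft g x"

text \<open>Inversion by duality: \<eta> is \<open>fourier\<close> of its own inverse transform, so
  T \<eta> is a value of \<open>dist_fourier T\<close>, hence a pairing with \<open>g\<close>. The
  multiplication formula then moves the inverse transform onto \<open>g\<close>.\<close>

lemma represents_fourier_test:
  assumes rep: "represents g (dist_fourier T)" and g: "integrable lborel g" and \<eta>: "test \<eta>"
  shows "T \<eta> = (LINT x|lborel. ift g x * \<eta> x)"
proof -
  define c :: complex where "c = of_real ((2 * pi) powr (-3/2))"
  \<comment> \<open>The constant enters once through \<open>fourier\<close> and once through the
    inverse transform; inversion contributes (2 pi)^3, and the exponents -3/2, 3, -3/2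
    cancel.\<close>
  have cc: "c * (of_real ((2 * pi) ^ 3) * c) = 1"
  proof -
    have "(2 * pi) powr (-3/2) * ((2 * pi) ^ 3 * (2 * pi) powr (-3/2)) = (2 * pi) powr (-3/2 + (3 + -3/2))"
      by (simp only: powr_add) (simp add: powr_numeral)
    then show ?thesis unfolding c_def of_real_mult[symmetric] by simp
  qed
  let ?h = "\<lambda>x. c * \<eta> x"
  have h: "test ?h" using \<eta> by (intro test_mult) auto
  \<comment> \<open>The fourth power dominates (1 + |\<xi>|^2)^2, and the exponent 2 exceeds 3/2, so
    the transform is integrable.\<close>
  obtain C where C: "\<And>\<xi>. (1 + norm \<xi>) ^ 4 * norm (ft ?h \<xi>) \<le> C"
    using ft_test_weighted_bounded[OF h] by blast
  have "integrable lborel (ft ?h)"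
  proof (rule Bochner_Integration.integrable_bound)
    show "integrable lborel (\<lambda>\<xi>::real^3. C * (1 + (norm \<xi>)\<^sup>2) powr (-2))"
      using integrable_weight[of 2] by simp
    show "ft ?h \<in> borel_measurable lborel"
      using continuous_ft[OF test_integrable[OF h]] by (simp add: borel_measurable_continuous_onI)
    show "AE \<xi> in lborel. norm (ft ?h \<xi>) \<le> norm (C * (1 + (norm \<xi>)\<^sup>2) powr (-2))"
    proof (rule AE_I2)
      fix \<xi> :: "real^3"
      have q: "0 < 1 + (norm \<xi>)\<^sup>2" by (simp add: add_pos_nonneg)
      have "(1 + (norm \<xi>)\<^sup>2)\<^sup>2 \<le> ((1 + norm \<xi>)\<^sup>2)\<^sup>2"
        by (intro power_mono) (auto simp: power2_eq_square algebra_simps)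
      then have "(1 + (norm \<xi>)\<^sup>2)\<^sup>2 * norm (ft ?h \<xi>) \<le> (1 + norm \<xi>) ^ 4 * norm (ft ?h \<xi>)"
        by (intro mult_right_mono) (auto simp: power_mult[symmetric])
      also note C
      finally have "norm (ft ?h \<xi>) \<le> C / (1 + (norm \<xi>)\<^sup>2)\<^sup>2"
        using q by (simp add: pos_le_divide_eq mult.commute)
      also have "\<dots> = C * (1 + (norm \<xi>)\<^sup>2) powr (-2)"
        by (simp add: powr_minus powr_numeral add_pos_nonneg divide_inverse)
      finally show "norm (ft ?h \<xi>) \<le> norm (C * (1 + (norm \<xi>)\<^sup>2) powr (-2))" by simp
    qed
  qed
  moreover have ch: "continuous_on UNIV ?h" using smooth_continuous[OF testD[OF h]] .
  moreover obtain B where "\<And>x. norm (?h x) \<le> B"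
    using test_weighted_bounded[OF h, of 0] by (auto simp: bdd_above_def)
  ultimately have inv: "(LINT \<xi>|lborel. cis (- (x \<bullet> \<xi>)) * ft ?h \<xi>) = of_real ((2 * pi) ^ 3) * (c * \<eta> x)" for x
    by (intro ft_inversion[OF _ test_integrable[OF h]]) auto
  have "fourier (ft ?h) = \<eta>"
  proof
    fix x
    have "fourier (ft ?h) x = c * (LINT \<xi>|lborel. cis (- (x \<bullet> \<xi>)) * ft ?h \<xi>)"
      unfolding fourier_def c_def by (simp only: inner_commute[of _ x])
    also have "\<dots> = c * (of_real ((2 * pi) ^ 3) * (c * \<eta> x))"
      by (simp only: inv)
    also have "\<dots> = \<eta> x" using cc by (simp add: mult.assoc[symmetric])
    finally show "fourier (ft ?h) x = \<eta> x" .
  qed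
  then have "T \<eta> = (LINT x|lborel. g x * ft ?h x)"
    using rep ft_test_schwartz[OF h] by (auto simp: represents_def dist_fourier_def)
  also have "\<dots> = (LINT x|lborel. ?h x * ft g x)"
    by (rule integral_ft_swap[OF g test_integrable[OF h]])
  also have "\<dots> = (LINT x|lborel. ift g x * \<eta> x)"
    by (simp add: ift_def c_def scaleR_conv_of_real mult_ac)
  finally show ?thesis .
qed

text \<open>Pairing the dilated distribution with the test function x \<mapsto> \<phi>(r x) undoes
  the dilation; the r^3 in \<open>dist_dilate\<close> is the Jacobian of the substitution on the
  other side.\<close>

lemma represents_dilate_test:
  assumes rep: "represents g (dist_fourier (dist_dilate r (dist_mult \<psi> u)))"
    and g: "integrable lborel g" and \<phi>: "test \<phi>" and r: "r > 0"
  shows "u (\<lambda>x. \<psi> x * \<phi> x) = (LINT x|lborel. ift g (x /\<^sub>R r) * \<phi> x)"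
proof -
  obtain R where R: "\<And>x. norm x > R \<Longrightarrow> \<phi> x = 0" using \<phi> by (auto simp: test_def)
  have "\<phi> (r *\<^sub>R x) = 0" if "norm x > R / r" for x
    by (rule R) (use that r in \<open>simp add: divide_less_eq mult.commute\<close>)
  then have t: "test (\<lambda>x. \<phi> (r *\<^sub>R x))"
    using \<phi> unfolding test_def by (auto intro: smooth_scale)
  have m: "(\<lambda>x. ift g (x /\<^sub>R r) * \<phi> x) \<in> borel_measurable borel"
  proof (intro borel_measurable_continuous_onI continuous_intros)
    show "continuous_on UNIV \<phi>" using \<phi> by (simp add: testD smooth_continuous)
    show "continuous_on UNIV (\<lambda>x. ift g (x /\<^sub>R r))"
      unfolding ift_def
      by (intro continuous_intros continuous_on_compose2[OF continuous_ft[OF g]]) auto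
  qed
  have "u (\<lambda>x. \<psi> x * \<phi> x) / of_real (r ^ 3) = dist_dilate r (dist_mult \<psi> u) (\<lambda>x. \<phi> (r *\<^sub>R x))"
    using r by (simp add: dist_dilate_def dist_mult_def)
  also have "\<dots> = (LINT x|lborel. ift g x * \<phi> (r *\<^sub>R x))"
    by (rule represents_fourier_test[OF rep g t])
  finally have "u (\<lambda>x. \<psi> x * \<phi> x) = r ^ 3 *\<^sub>R (LINT x|lborel. ift g x * \<phi> (r *\<^sub>R x))"
    using r by (simp add: scaleR_conv_of_real field_simps)
  also have "\<dots> = (LINT x|lborel. ift g (x /\<^sub>R r) * \<phi> x)"
    using integral_affine[OF m r, of 0] r by simp
  finally show ?thesis .
qed

text \<open>The fundamental lemma of the calculus of variations, local to \<open>U\<close>. Copies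
  of the bump \<open>b\<close> shrunk towards \<open>a\<close> eventually see only the value
  \<open>h a\<close>, multiplied by the integral of \<open>b\<close>. The bump may be complex-valued
  and change sign as long as that integral is nonzero.\<close>

lemma continuous_eq_0_if_test_integrals_0:
  fixes h :: "real^3 \<Rightarrow> complex"
  assumes h: "continuous_on UNIV h" and U: "open U" "a \<in> U"
    and b: "test b" "(LINT x|lborel. b x) \<noteq> 0"
    and 0: "\<And>\<phi>. test \<phi> \<Longrightarrow> (\<And>x. x \<notin> U \<Longrightarrow> \<phi> x = 0) \<Longrightarrow> (LINT x|lborel. h x * \<phi> x) = 0"
  shows "h a = 0"
proof -
  obtain R where R: "\<And>x. norm x > R \<Longrightarrow> b x = 0" using b by (auto simp: test_def)
  obtain \<rho> where \<rho>: "\<rho> > 0" "cball a \<rho> \<subseteq> U" using U open_contains_cball by blast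
  \<comment> \<open>The denominator \<open>\<bar>R\<bar> + 1\<close> is positive for every
    \<open>R\<close> and larger than the radius of the support of \<open>b\<close>, so each scaled
    copy stays in the ball of radius \<rho> around \<open>a\<close>.\<close>
  define t where "t n = \<rho> / (\<bar>R\<bar> + 1) * inverse (real (Suc n))" for n
  have t: "t n > 0" for n using \<rho> by (simp add: t_def)
  have "t n \<le> \<rho> / (\<bar>R\<bar> + 1) * 1" for n
    unfolding t_def using \<rho> by (intro mult_left_mono) (auto simp: field_simps)
  then have tR: "t n * (\<bar>R\<bar> + 1) \<le> \<rho>" for n by (simp add: pos_le_divide_eq)
  have "t \<longlonglongrightarrow> \<rho> / (\<bar>R\<bar> + 1) * 0" unfolding t_def by (intro tendsto_intros LIMSEQ_inverse_real_of_nat)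
  then have t0: "t \<longlonglongrightarrow> 0" by simp
  have sup: "a + t n *\<^sub>R z \<in> cball a \<rho>" if "norm z \<le> R" for n z
  proof -
    have "norm (t n *\<^sub>R z) \<le> t n * (\<bar>R\<bar> + 1)"
      using that t[of n] by (auto intro: mult_left_mono)
    with tR[of n] show ?thesis by (simp add: dist_norm)
  qed
  have "compact (h ` cball a \<rho>)"
    by (rule compact_continuous_image) (auto intro: continuous_on_subset[OF h])
  then obtain M where M: "\<And>y. y \<in> cball a \<rho> \<Longrightarrow> norm (h y) \<le> M"
    using compact_imp_bounded bounded_iff by (metis imageI)
  have [measurable]: "h \<in> borel_measurable borel" "b \<in> borel_measurable borel"
    using h smooth_continuous[OF testD[OF b(1)]] by (auto intro: borel_measurable_continuous_onI)
  have z: "(LINT z|lborel. h (a + t n *\<^sub>R z) * b z) = 0" for n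
  proof -
    let ?\<phi> = "\<lambda>x. b ((x - a) /\<^sub>R t n)"
    have sm: "smooth ?\<phi>"
      using smooth_affine[OF testD[OF b(1)], of "inverse (t n)" "- (a /\<^sub>R t n)"] by (simp add: scaleR_diff_right)
    have out: "?\<phi> x = 0" if "x \<notin> cball a \<rho>" for x
    proof (rule R, rule ccontr)
      assume "\<not> norm ((x - a) /\<^sub>R t n) > R"
      then have "a + t n *\<^sub>R ((x - a) /\<^sub>R t n) \<in> cball a \<rho>" by (intro sup) simp
      with that t[of n] show False by simp
    qed
    have "?\<phi> x = 0" if "norm x > norm a + \<rho>" for x
    proof (rule out)
      show "x \<notin> cball a \<rho>" using that norm_triangle_sub[of x a] by (auto simp: dist_norm norm_minus_commute)
    qed
    then have "test ?\<phi>" using sm unfolding test_def by blast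
    then have "0 = (LINT x|lborel. h x * ?\<phi> x)" using out \<rho>(2) by (intro 0[symmetric]) blast+
    also have "\<dots> = t n ^ 3 *\<^sub>R (LINT z|lborel. h (a + t n *\<^sub>R z) * b ((a + t n *\<^sub>R z - a) /\<^sub>R t n))"
      by (rule integral_affine) (use t in auto)
    finally show ?thesis using t[of n] by simp
  qed
  have "(\<lambda>n. LINT z|lborel. h (a + t n *\<^sub>R z) * b z) \<longlonglongrightarrow> (LINT z|lborel. h a * b z)"
  proof (rule integral_dominated_convergence)
    show "integrable lborel (\<lambda>z. M * norm (b z))" using test_integrable[OF b(1)] by simp
    show "AE z in lborel. (\<lambda>n. h (a + t n *\<^sub>R z) * b z) \<longlonglongrightarrow> h a * b z"
    proof (rule AE_I2)
      fix z
      have "(\<lambda>n. a + t n *\<^sub>R z) \<longlonglongrightarrow> a + 0 *\<^sub>R z" by (intro tendsto_intros t0)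
      moreover have "isCont h a" using h by (simp add: continuous_on_eq_continuous_at)
      ultimately have "(\<lambda>n. h (a + t n *\<^sub>R z)) \<longlonglongrightarrow> h a"
        by (intro isCont_tendsto_compose[of a h]) simp_all
      then show "(\<lambda>n. h (a + t n *\<^sub>R z) * b z) \<longlonglongrightarrow> h a * b z" by (rule tendsto_mult_right)
    qed
    show "AE z in lborel. norm (h (a + t n *\<^sub>R z) * b z) \<le> M * norm (b z)" for n
    proof (rule AE_I2)
      fix z
      show "norm (h (a + t n *\<^sub>R z) * b z) \<le> M * norm (b z)"
      proof (cases "norm z \<le> R")
        case True
        then show ?thesis using M[OF sup] by (simp add: norm_mult mult_right_mono)
      qed (use R in simp)
    qed
  qed measurable
  then have "h a * (LINT z|lborel. b z) = 0" unfolding z by (simp add: LIMSEQ_const_iff)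
  then show ?thesis using b(2) by simp
qed

section \<open>Cutting off Schwartz functions\<close>


lemma mderiv_vector: "mderiv (vector [k1, k2, k3]) f = (partial 1 ^^ k1) ((partial 2 ^^ k2) ((partial 3 ^^ k3) f))"
  by (simp add: mderiv_def)

text \<open>The Leibniz rule one coordinate at a time. \<open>mderiv\<close> differentiates in
  direction 3 first, which is why the sum over \<open>k3\<close> is outermost and each summand is
  again a product of two values of \<open>mderiv\<close>.\<close>

lemma mderiv_mult:
  assumes "smooth f" "smooth g"
  shows "mderiv \<alpha> (\<lambda>x. f x * g x) x =
    (\<Sum>k3\<le>\<alpha> $ 3. of_nat (\<alpha> $ 3 choose k3) * (\<Sum>k2\<le>\<alpha> $ 2. of_nat (\<alpha> $ 2 choose k2) *
      (\<Sum>k1\<le>\<alpha> $ 1. of_nat (\<alpha> $ 1 choose k1) *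
        (mderiv (vector [k1, k2, k3]) f x * mderiv (vector [\<alpha> $ 1 - k1, \<alpha> $ 2 - k2, \<alpha> $ 3 - k3]) g x))))"
proof -
  have 1: "smooth (\<lambda>x. \<Sum>k\<in>A. of_nat (c k) * F k x)" if "\<And>k. smooth (F k)" for A F and c :: "nat \<Rightarrow> nat"
    using that by (intro smooth_sum smooth_mult) auto
  note sm = assms smooth_partial_funpow smooth_mult
  show ?thesis
    unfolding mderiv_vector mderiv_def using assms
    by (simp add: partial_funpow_mult partial_funpow_sum sm 1)
qed

text \<open>1 - \<psi>(c x) and all its derivatives vanish where c |x| < 4, and elsewhere 1 \<le> c
  (1 + |x|). One surplus power of the weight, supplied by the decay of \<phi>, thus buys the factor
  \<open>c\<close>. The bound \<open>c \<le> 4\<close> controls the powers of \<open>c\<close>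
  produced by the chain rule and admits all the scales 4/2^n.\<close>

lemma cutoff_tail_bound:
  assumes \<phi>: "\<phi> \<in> schwartz" and \<psi>: "test \<psi>" and one: "\<And>x. norm x < 4 \<Longrightarrow> \<psi> x = 1"
  obtains C where "\<And>c. 0 < c \<Longrightarrow> c \<le> 4 \<Longrightarrow> schwartz_seminorm N (\<lambda>x. (1 - \<psi> (c *\<^sub>R x)) * \<phi> x) \<le> C * c"
proof -
  have \<phi>sm: "smooth \<phi>" using \<phi> by (simp add: schwartz_def)
  define a where "a x = 1 - \<psi> x" for x
  have asm: "smooth a"
    using smooth_add[OF smooth_const[of 1] smooth_mult[OF smooth_const[of "-1"] testD[OF \<psi>]]]
    by (simp add: a_def[abs_def])
  have acsm: "smooth (\<lambda>x. a (c *\<^sub>R x))" for c using asm by (rule smooth_scale)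
  have "\<exists>B. \<forall>c x. 0 < c \<longrightarrow> c \<le> 4 \<longrightarrow> norm (mderiv \<kappa> (\<lambda>x. a (c *\<^sub>R x)) x) \<le> B * c * (1 + norm x)" for \<kappa>
  proof -
    have "mderiv \<kappa> a = (\<lambda>x. 1 * mderiv \<kappa> (\<lambda>x. 1) x + (-1) * mderiv \<kappa> \<psi> x)"
      using mderiv_lincomb[OF smooth_const[of 1] testD[OF \<psi>], of \<kappa> 1 "-1"] by (simp add: a_def[abs_def])
    moreover obtain B1 where B1: "\<And>x. norm (mderiv \<kappa> \<psi> x) \<le> B1"
      using test_weighted_bounded[OF test_mderiv[OF \<psi>], of 0 \<kappa>] by (auto simp: bdd_above_def)
    moreover have "\<exists>d. mderiv \<kappa> (\<lambda>x. 1) = (\<lambda>x. d)"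
    proof -
      have "\<exists>d. (partial i ^^ n) (\<lambda>x. e) = (\<lambda>x. d)" for i n e
        by (induction n) auto
      then show ?thesis unfolding mderiv_def by metis
    qed
    ultimately obtain d where d: "mderiv \<kappa> a = (\<lambda>x. d - mderiv \<kappa> \<psi> x)" by auto
    define B where "B = norm d + B1"
    have B: "norm (mderiv \<kappa> a x) \<le> B" for x
      unfolding d B_def using norm_triangle_ineq4[of d "mderiv \<kappa> \<psi> x"] B1[of x] by linarith
    then have B0: "0 \<le> B" using norm_ge_zero order_trans by blast
    have zero: "mderiv \<kappa> a x = 0" if "norm x < 4" for x
    proof -
      have "mderiv \<kappa> a x = mderiv \<kappa> (\<lambda>x. 0) x"
        by (rule mderiv_cong_open[of "ball 0 4"]) (use that one in \<open>auto simp: a_def\<close>)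
      also have "mderiv \<kappa> (\<lambda>x. 0) x = 0"
        using mderiv_lincomb[of "\<lambda>x. 0" "\<lambda>x. 0" \<kappa> 0 0] by (simp add: fun_eq_iff)
      finally show ?thesis .
    qed
    have "norm (mderiv \<kappa> (\<lambda>x. a (c *\<^sub>R x)) x) \<le> (4 ^ order_mi \<kappa> * B) * c * (1 + norm x)"
      if c: "0 < c" "c \<le> 4" for c x
    proof -
      have e: "norm (mderiv \<kappa> (\<lambda>x. a (c *\<^sub>R x)) x) = c ^ order_mi \<kappa> * norm (mderiv \<kappa> a (c *\<^sub>R x))"
        using c mderiv_scale[OF smooth_imp_C_k[OF asm], of \<kappa> c] by simp
      show ?thesis
      proof (cases "norm (c *\<^sub>R x) < 4")
        case True
        then show ?thesis using zero[OF True] c B0 unfolding e by simp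
      next
        case False
        then have "1 \<le> c * (1 + norm x)" using c by (simp add: algebra_simps)
        moreover have "c ^ order_mi \<kappa> * norm (mderiv \<kappa> a (c *\<^sub>R x)) \<le> 4 ^ order_mi \<kappa> * B"
          using c B by (intro mult_mono power_mono) auto
        ultimately show ?thesis unfolding e
          using mult_mono[of "c ^ order_mi \<kappa> * norm (mderiv \<kappa> a (c *\<^sub>R x))" "4 ^ order_mi \<kappa> * B" 1 "c * (1 + norm x)"] B0
          by (simp add: mult.assoc)
      qed
    qed
    then show ?thesis by blast
  qed
  then obtain B where B: "\<And>\<kappa> c x. 0 < c \<Longrightarrow> c \<le> 4 \<Longrightarrow>
      norm (mderiv \<kappa> (\<lambda>x. a (c *\<^sub>R x)) x) \<le> B \<kappa> * c * (1 + norm x)"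
    by metis
  \<comment> \<open>The exponent is one larger than in the seminorm to be bounded, absorbing the
    factor \<open>1 + norm x\<close> from the cutoff.\<close>
  have "\<exists>M. \<forall>x. (1 + norm x) ^ Suc N * norm (mderiv \<kappa> \<phi> x) \<le> M" for \<kappa>
    using \<phi> by (auto simp: schwartz_def bdd_above_def simp del: power_Suc)
  then obtain M where M: "\<And>\<kappa> x. (1 + norm x) ^ Suc N * norm (mderiv \<kappa> \<phi> x) \<le> M \<kappa>" by metis
  define D where "D \<alpha> = (\<Sum>k3\<le>\<alpha> $ 3. real (\<alpha> $ 3 choose k3) * (\<Sum>k2\<le>\<alpha> $ 2. real (\<alpha> $ 2 choose k2) *
      (\<Sum>k1\<le>\<alpha> $ 1. real (\<alpha> $ 1 choose k1) *
        (B (vector [k1, k2, k3]) * M (vector [\<alpha> $ 1 - k1, \<alpha> $ 2 - k2, \<alpha> $ 3 - k3])))))" for \<alpha> :: multi_index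
  have le: "(1 + norm x) ^ N * norm (mderiv \<alpha> (\<lambda>x. a (c *\<^sub>R x) * \<phi> x) x) \<le> D \<alpha> * c"
    if c: "0 < c" "c \<le> 4" for \<alpha> c x
  proof -
    define w where "w = (1 + norm x) ^ N"
    have w0: "0 \<le> w" by (simp add: w_def)
    have t: "w * norm (mderiv \<kappa> (\<lambda>x. a (c *\<^sub>R x)) x * mderiv \<mu> \<phi> x) \<le> B \<kappa> * M \<mu> * c" for \<kappa> \<mu>
    proof -
      have "w * norm (mderiv \<kappa> (\<lambda>x. a (c *\<^sub>R x)) x * mderiv \<mu> \<phi> x) \<le>
          w * ((B \<kappa> * c * (1 + norm x)) * norm (mderiv \<mu> \<phi> x))"
        unfolding norm_mult using B[OF c] w0 by (intro mult_left_mono mult_right_mono) auto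
      also have "\<dots> = B \<kappa> * c * ((1 + norm x) ^ Suc N * norm (mderiv \<mu> \<phi> x))"
        by (simp add: w_def mult_ac)
      also have "\<dots> \<le> B \<kappa> * c * M \<mu>"
      proof (rule mult_left_mono[OF M])
        \<comment> \<open>The constants \<open>B \<kappa>\<close> come without a sign; evaluating
          their defining bound at the origin supplies it.\<close>
        have "0 \<le> norm (mderiv \<kappa> (\<lambda>x. a (c *\<^sub>R x)) 0)" by simp
        also have "\<dots> \<le> B \<kappa> * c * (1 + norm (0::real^3))" by (rule B[OF c])
        finally show "0 \<le> B \<kappa> * c" by simp
      qed
      finally show ?thesis by (simp add: mult_ac)
    qed
    \<comment> \<open>One layer of the Leibniz sum; used three times, once per coordinate, it
      reproduces the nesting of \<open>D\<close>.\<close>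
    have s: "w * norm (\<Sum>k\<le>n. of_nat (n choose k) * F k) \<le> (\<Sum>k\<le>n. real (n choose k) * G k) * c"
      if "\<And>k. w * norm (F k) \<le> G k * c" for n and F :: "nat \<Rightarrow> complex" and G
    proof -
      have "w * norm (\<Sum>k\<le>n. of_nat (n choose k) * F k) \<le> w * (\<Sum>k\<le>n. real (n choose k) * norm (F k))"
        using norm_sum[of "\<lambda>k. of_nat (n choose k) * F k" "{..n}"] w0
        by (intro mult_left_mono) (simp_all add: norm_mult)
      also have "\<dots> = (\<Sum>k\<le>n. real (n choose k) * (w * norm (F k)))"
        by (simp add: sum_distrib_left mult_ac)
      also have "\<dots> \<le> (\<Sum>k\<le>n. real (n choose k) * (G k * c))"
        using that by (intro sum_mono mult_left_mono) auto
      also have "\<dots> = (\<Sum>k\<le>n. real (n choose k) * G k) * c"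
        by (simp only: sum_distrib_right mult.assoc)
      finally show ?thesis .
    qed
    show ?thesis
      unfolding mderiv_mult[OF acsm \<phi>sm] D_def w_def[symmetric] by (intro s t)
  qed
  have "schwartz_seminorm N (\<lambda>x. (1 - \<psi> (c *\<^sub>R x)) * \<phi> x) \<le> (\<Sum>\<alpha> | order_mi \<alpha> \<le> N. D \<alpha>) * c"
    if c: "0 < c" "c \<le> 4" for c
    unfolding schwartz_seminorm_def sum_distrib_right
    using le[OF c] by (intro sum_mono cSUP_least) (auto simp: a_def)
  then show ?thesis by (rule that)
qed

lemma schwartz_diff:
  assumes "f \<in> schwartz" "g \<in> schwartz"
  shows "(\<lambda>x. f x - g x) \<in> schwartz"
  unfolding schwartz_def
proof (intro CollectI conjI allI)
  have sm: "smooth f" "smooth g" using assms by (auto simp: schwartz_def)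
  show "smooth (\<lambda>x. f x - g x)"
    using smooth_add[OF sm(1) smooth_mult[OF smooth_const[of "-1"] sm(2)]] by simp
  fix \<alpha> N
  obtain A where A: "\<And>x. (1 + norm x) ^ N * norm (mderiv \<alpha> f x) \<le> A"
    using assms(1) unfolding schwartz_def bdd_above_def by blast
  obtain B where B: "\<And>x. (1 + norm x) ^ N * norm (mderiv \<alpha> g x) \<le> B"
    using assms(2) unfolding schwartz_def bdd_above_def by blast
  show "bdd_above (range (\<lambda>x. (1 + norm x) ^ N * norm (mderiv \<alpha> (\<lambda>x. f x - g x) x)))"
  proof (rule bdd_aboveI2)
    fix x :: "real^3"
    have "mderiv \<alpha> (\<lambda>x. f x - g x) x = mderiv \<alpha> f x - mderiv \<alpha> g x"
      using mderiv_lincomb[OF sm, of \<alpha> 1 "-1"] by (simp add: fun_eq_iff)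
    then have "(1 + norm x) ^ N * norm (mderiv \<alpha> (\<lambda>x. f x - g x) x) \<le>
        (1 + norm x) ^ N * (norm (mderiv \<alpha> f x) + norm (mderiv \<alpha> g x))"
      using norm_triangle_ineq4 by (intro mult_left_mono) auto
    also have "\<dots> \<le> A + B" using A[of x] B[of x] by (simp add: distrib_left)
    finally show "(1 + norm x) ^ N * norm (mderiv \<alpha> (\<lambda>x. f x - g x) x) \<le> A + B" .
  qed
qed

lemma smooth_cnj: "smooth f \<Longrightarrow> smooth (\<lambda>x. cnj (f x))"
  by (simp add: smooth_def C_k_bounded_linear[OF bounded_linear_cnj])

text \<open>A complex-valued cutoff may itself integrate to zero. The square of its modulus cannot:
  it is nonnegative, and equal to 1 on a ball.\<close>

lemma test_norm_square_integral:
  assumes \<psi>: "test \<psi>" and one: "\<And>x. norm x < 4 \<Longrightarrow> \<psi> x = 1"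
  shows "test (\<lambda>x. \<psi> x * cnj (\<psi> x))" and "(LINT x|lborel. \<psi> x * cnj (\<psi> x)) \<noteq> 0"
proof -
  show t: "test (\<lambda>x. \<psi> x * cnj (\<psi> x))"
    using \<psi> by (intro test_mult2 smooth_cnj testD)
  have e: "\<psi> x * cnj (\<psi> x) = of_real ((norm (\<psi> x))\<^sup>2)" for x
    by (simp only: complex_norm_square)
  have i: "integrable lborel (\<lambda>x. (norm (\<psi> x))\<^sup>2)"
    using test_integrable[OF t] unfolding e complex_of_real_integrable_eq .
  have "0 < measure lborel (ball (0::real^3) 4)"
    by (rule content_ball_pos) simp
  also have "\<dots> = (LINT x|lborel. indicator (ball (0::real^3) 4) x)" by simp
  also have "\<dots> \<le> (LINT x|lborel. (norm (\<psi> x))\<^sup>2)"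
  proof (rule integral_mono[OF _ i])
    show "integrable lborel (indicator (ball (0::real^3) 4) :: _ \<Rightarrow> real)"
      by (intro integrable_real_indicator emeasure_lborel_ball_finite) auto
    show "indicator (ball 0 4) x \<le> (norm (\<psi> x))\<^sup>2" for x
      using one[of x] by (simp add: indicator_def)
  qed
  finally show "(LINT x|lborel. \<psi> x * cnj (\<psi> x)) \<noteq> 0"
    unfolding e integral_complex_of_real by simp
qed

section \<open>Gluing along dyadic annuli\<close>


text \<open>An open counterpart of \<open>K j\<close>, as 2^(j-3) = 2^j/8 and 2^(j+2) = 4 * 2^j.
  Openness makes derivatives and pairings with test functions local on it.\<close>

definition annulus :: "nat \<Rightarrow> (real^3) set"
  where "annulus j = {x. norm x < 4 * 2 ^ j \<and> (j = 0 \<or> 2 ^ j / 8 < norm x)}"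

lemma open_annulus: "open (annulus j)"
  unfolding annulus_def by (cases "j = 0") (auto intro!: open_Collect_conj open_Collect_less continuous_intros)

lemma annulus_cover: "\<exists>j. x \<in> annulus j"
proof -
  obtain k0 where "norm x / 4 < 2 ^ k0" using real_arch_pow[of 2 "norm x / 4"] by auto
  then have ex: "\<exists>k. norm x < 4 * 2 ^ k" by (intro exI[of _ k0]) simp
  define k where "k = (LEAST k. norm x < 4 * 2 ^ k)"
  have k: "norm x < 4 * 2 ^ k" unfolding k_def using ex by (rule LeastI_ex)
  have "2 ^ k / 8 < norm x" if nz: "k \<noteq> 0"
  proof -
    obtain l where l: "k = Suc l" using nz by (cases k) auto
    have "\<not> norm x < 4 * 2 ^ l" using not_less_Least[of l "\<lambda>k. norm x < 4 * 2 ^ k"] l by (simp add: k_def)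
    moreover have "(0::real) < 2 ^ l" by simp
    ultimately have "2 * 2 ^ l / 8 < norm x" by linarith
    then show ?thesis by (simp add: l)
  qed
  with k have "x \<in> annulus k" by (auto simp: annulus_def)
  then show ?thesis ..
qed

lemma annulus_subset_K: "annulus j \<subseteq> K j"
proof
  fix x assume x: "x \<in> annulus j"
  show "x \<in> K j"
  proof (cases "j = 0")
    case False
    have "(2::real) powi (int j - 3) = 2 ^ j / 8" "(2::real) powi (int j + 2) = 4 * 2 ^ j"
      by (simp_all add: power_int_diff power_int_add)
    then show ?thesis using x False by (simp add: annulus_def K_def)
  qed (use x in \<open>simp add: annulus_def K_def\<close>)
qed

text \<open>On the annulus \<open>1 + norm x\<close> is within a factor 8 of 2^j. Both directions
  are needed since the exponent may have either sign, and \<open>B\<close> makes the constant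
  uniform over the finitely many exponents \<beta> + |\<alpha>|.\<close>

lemma weight_le_on_annulus:
  assumes x: "x \<in> annulus j" and b: "\<bar>b\<bar> \<le> B"
  shows "(1 + norm x) powr b \<le> 8 powr B * (2 ^ j) powr b"
proof -
  have j: "(1::real) \<le> 2 ^ j" by simp
  have up: "1 + norm x \<le> 8 * 2 ^ j" and low: "2 ^ j / 8 \<le> 1 + norm x"
  proof -
    have "norm x < 4 * 2 ^ j" "j = 0 \<or> 2 ^ j / 8 < norm x" using x by (auto simp: annulus_def)
    with j show "1 + norm x \<le> 8 * 2 ^ j" "2 ^ j / 8 \<le> 1 + norm x" by (linarith, cases "j = 0") auto
  qed
  have B: "8 powr \<bar>b\<bar> \<le> (8::real) powr B" using b by simp
  show ?thesis
  proof (cases "0 \<le> b")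
    case True
    then have "(1 + norm x) powr b \<le> (8 * 2 ^ j) powr b" using up by (intro powr_mono2) auto
    also have "\<dots> = 8 powr \<bar>b\<bar> * (2 ^ j) powr b" using True by (simp add: powr_mult)
    also have "\<dots> \<le> 8 powr B * (2 ^ j) powr b" using B by (rule mult_right_mono) simp
    finally show ?thesis .
  next
    case False
    then have "(1 + norm x) powr b \<le> (2 ^ j / 8) powr b" using low by (intro powr_mono2') auto
    also have "\<dots> = 8 powr \<bar>b\<bar> * (2 ^ j) powr b" using False by (simp add: powr_divide powr_minus field_simps)
    also have "\<dots> \<le> 8 powr B * (2 ^ j) powr b" using B by (rule mult_right_mono) simp
    finally show ?thesis .
  qed
qed

text \<open>The interface between Fourier analysis and gluing: \<open>w j\<close> is a continuous
  function standing for the distribution \<open>\<psi> j\<close> times \<open>u\<close> on test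
  functions, with its origin as an inverse transform forgotten.\<close>

locale dyadic_pieces =
  fixes \<psi> :: "nat \<Rightarrow> real^3 \<Rightarrow> complex" and u :: functional and w :: "nat \<Rightarrow> real^3 \<Rightarrow> complex"
  assumes tempered: "tempered u"
    and cutoff: "test (\<psi> j)"
    and one: "x \<in> annulus j \<Longrightarrow> \<psi> j x = 1"
    and zero: "norm x > 8 \<Longrightarrow> \<psi> 0 x = 0"
    and cont: "continuous_on UNIV (w j)"
    and rep: "test \<phi> \<Longrightarrow> u (\<lambda>x. \<psi> j x * \<phi> x) = (LINT x|lborel. w j x * \<phi> x)"
begin

lemma rep_annulus:
  assumes "test \<phi>" "\<And>x. x \<notin> annulus j \<Longrightarrow> \<phi> x = 0"
  shows "u \<phi> = (LINT x|lborel. w j x * \<phi> x)"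
proof -
  have "(\<lambda>x. \<psi> j x * \<phi> x) = \<phi>"
  proof
    fix x show "\<psi> j x * \<phi> x = \<phi> x"
      using one[of x j] assms(2)[of x] by (cases "x \<in> annulus j") auto
  qed
  with rep[OF assms(1), of j] show ?thesis by simp
qed

text \<open>Continuity extends the value 1 from the open ball to the closed one, so that non-strict
  estimates on \<open>norm x\<close> can be used when consecutive cutoffs are compared.\<close>

lemma cutoff_0_eq_1: "norm x \<le> 4 \<Longrightarrow> \<psi> 0 x = 1"
proof -
  have "\<psi> 0 x = 1" if "norm x < 4" for x using one[of x 0] that by (simp add: annulus_def)
  then have "{x. norm x < 4} \<subseteq> {x. \<psi> 0 x = 1}" by auto
  moreover have "closed {x. \<psi> 0 x = 1}"
    using smooth_continuous[OF testD[OF cutoff]] by (intro closed_Collect_eq) auto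
  ultimately have "closure (ball 0 4) \<subseteq> {x. \<psi> 0 x = 1}" by (intro closure_minimal) auto
  then show "norm x \<le> 4 \<Longrightarrow> \<psi> 0 x = 1" by (auto simp: closure_ball)
qed

text \<open>On test functions supported in the overlap both pieces give the value of
  \<open>u\<close>, so their continuous difference vanishes there.\<close>

lemma pieces_agree:
  assumes "a \<in> annulus i" "a \<in> annulus j" shows "w i a = w j a"
proof -
  have n4: "norm x < 4 \<Longrightarrow> \<psi> 0 x = 1" for x by (rule cutoff_0_eq_1) simp
  have "(\<lambda>x. w i x - w j x) a = 0"
  proof (rule continuous_eq_0_if_test_integrals_0)
    show "open (annulus i \<inter> annulus j)" by (intro open_Int open_annulus)
    show "continuous_on UNIV (\<lambda>x. w i x - w j x)" by (intro continuous_intros cont)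
    fix \<phi> assume \<phi>: "test \<phi>" "\<And>x. x \<notin> annulus i \<inter> annulus j \<Longrightarrow> \<phi> x = 0"
    have int: "integrable lborel (\<lambda>x. w k x * \<phi> x)" for k
    proof -
      obtain R where "\<And>x. norm x > R \<Longrightarrow> \<phi> x = 0" using \<phi> by (auto simp: test_def)
      then show ?thesis
        using smooth_continuous[OF testD[OF \<phi>(1)]]
        by (intro integrable_compact_support[of _ R] continuous_intros cont) auto
    qed
    have "(LINT x|lborel. w i x * \<phi> x) = (LINT x|lborel. w j x * \<phi> x)"
      using rep_annulus[of \<phi> i] rep_annulus[of \<phi> j] \<phi> by auto
    then show "(LINT x|lborel. (w i x - w j x) * \<phi> x) = 0"
      using int by (simp add: left_diff_distrib)
  qed (use assms test_norm_square_integral[OF cutoff n4] in auto)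
  then show ?thesis by simp
qed

text \<open>An annulus containing \<open>x\<close> exists by \<open>annulus_cover\<close>, and the
  choice is immaterial by \<open>pieces_agree\<close>.\<close>

definition glued :: "real^3 \<Rightarrow> complex"
  where "glued x = w (SOME j. x \<in> annulus j) x"

lemma glued_eq: "x \<in> annulus j \<Longrightarrow> glued x = w j x"
  unfolding glued_def using pieces_agree someI[of "\<lambda>j. x \<in> annulus j"] by blast

lemma glued_annulus:
  assumes "test \<phi>" "\<And>x. x \<notin> annulus j \<Longrightarrow> \<phi> x = 0"
  shows "u \<phi> = (LINT x|lborel. glued x * \<phi> x)"
proof -
  have "(\<lambda>x. w j x * \<phi> x) = (\<lambda>x. glued x * \<phi> x)"
    using assms(2) glued_eq[of _ j] by fastforce
  moreover have "u \<phi> = (LINT x|lborel. w j x * \<phi> x)"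
    using assms by (rule rep_annulus)
  ultimately show ?thesis by (simp only:)
qed

text \<open>The exponent \<open>b\<close> may be positive, because a negative \<beta> permits growth
  at infinity; Schwartz decay makes the pairing converge all the same. The formula is established on
  the truncations \<open>P n\<close> and both of its sides pass to the limit, the left one by
  temperedness.\<close>

lemma represents_glued:
  assumes c: "continuous_on UNIV glued" and b: "\<And>x. norm (glued x) \<le> A * (1 + norm x) powr b"
  shows "represents glued u"
  unfolding represents_def
proof (intro conjI ballI)
  show gm: "glued \<in> borel_measurable lborel"
    using c by (simp add: borel_measurable_continuous_onI)
  have A: "0 \<le> A" using order_trans[OF norm_ge_zero b[of 0]] by simp
  have int: "integrable lborel (\<lambda>x. glued x * \<phi> x)" if \<phi>: "\<phi> \<in> schwartz" for \<phi>
  proof -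
    \<comment> \<open>Decay of order b + 4 leaves (1 + |x|)^(-4) after the growth of
      \<open>glued\<close> is absorbed, which is integrable in dimension three.\<close>
    obtain N :: nat where N: "b + 4 \<le> real N" using real_arch_simple by blast
    have "bdd_above (range (\<lambda>x. (1 + norm x) ^ N * norm (mderiv 0 \<phi> x)))"
      using \<phi> by (auto simp: schwartz_def)
    moreover have "mderiv 0 \<phi> = \<phi>" by (simp add: mderiv_def)
    ultimately obtain M where M: "\<And>x. (1 + norm x) ^ N * norm (\<phi> x) \<le> M"
      unfolding bdd_above_def by auto
    have i: "integrable lborel (\<lambda>x::real^3. A * M * (1 + (norm x)\<^sup>2) powr (-2))"
      using integrable_weight[of 2] by simp
    have "\<phi> \<in> borel_measurable lborel"
      using \<phi> by (simp add: schwartz_def smooth_continuous borel_measurable_continuous_onI)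
    with gm have m: "(\<lambda>x. glued x * \<phi> x) \<in> borel_measurable lborel"
      by (rule borel_measurable_times)
    have "AE x in lborel. norm (glued x * \<phi> x) \<le> norm (A * M * (1 + (norm x)\<^sup>2) powr (-2))"
    proof (rule AE_I2)
      fix x :: "real^3"
      let ?r = "1 + norm x"
      have r: "1 \<le> ?r" by simp
      have rN: "?r ^ N = ?r powr real N"
        by (rule powr_realpow[symmetric]) (simp add: add_pos_nonneg)
      have p: "norm (\<phi> x) \<le> M * ?r powr (- real N)"
      proof -
        have "0 < ?r powr real N" unfolding powr_gt_zero using r by linarith
        then have "norm (\<phi> x) \<le> M / ?r powr real N"
          using M[of x] unfolding rN by (simp only: pos_le_divide_eq mult.commute)
        then show ?thesis by (simp add: powr_minus divide_inverse)
      qed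
      have M0: "0 \<le> M" using M[of x] by (rule order_trans[rotated]) simp
      have "norm (glued x * \<phi> x) \<le> (A * ?r powr b) * (M * ?r powr (- real N))"
        unfolding norm_mult using A by (intro mult_mono b p) auto
      also have "\<dots> = A * M * ?r powr (b - real N)" by (simp add: powr_add[symmetric])
      also have "?r powr (b - real N) \<le> ?r powr (-4)" using N by (intro powr_mono) auto
      also have "?r powr (-4) = (?r\<^sup>2) powr (-2)"
        using r powr_powr[of ?r 2 "-2"] by simp
      also have "\<dots> \<le> (1 + (norm x)\<^sup>2) powr (-2)"
        by (intro powr_mono2') (auto simp: power2_eq_square algebra_simps add_pos_nonneg)
      finally have "norm (glued x * \<phi> x) \<le> A * M * (1 + (norm x)\<^sup>2) powr (-2)"
        using A M0 by (simp add: mult_left_mono)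
      then show "norm (glued x * \<phi> x) \<le> norm (A * M * (1 + (norm x)\<^sup>2) powr (-2))" by simp
    qed
    with i m show ?thesis by (rule Bochner_Integration.integrable_bound)
  qed
  fix \<phi> assume \<phi>: "\<phi> \<in> schwartz"
  show "integrable lborel (\<lambda>x. glued x * \<phi> x)" using \<phi> by (rule int)
  have sm: "smooth \<phi>" using \<phi> by (simp add: schwartz_def)
  \<comment> \<open>The factor 4 confines \<open>P 0\<close> to |x| \<le> 2, inside the innermost
    annulus of radius 4, which starts the induction.\<close>
  define P where "P n x = \<psi> 0 ((4 / 2 ^ n) *\<^sub>R x) * \<phi> x" for n x
  have Pt: "test (P n)" for n
  proof -
    have "\<psi> 0 ((4 / 2 ^ n) *\<^sub>R x) = 0" if "norm x > 2 * 2 ^ n" for x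
      by (rule zero) (use that in \<open>simp add: field_simps\<close>)
    then have "test (\<lambda>x. \<psi> 0 ((4 / 2 ^ n) *\<^sub>R x))"
      using smooth_scale[OF testD[OF cutoff]] unfolding test_def by blast
    from test_mult2[OF this sm] show ?thesis by (simp add: P_def[abs_def])
  qed
  have Ps: "P n \<in> schwartz" for n using Pt by (rule test_schwartz)
  have add: "u (\<lambda>x. f x + g x) = u f + u g" if "f \<in> schwartz" "g \<in> schwartz" for f g
    using tempered that unfolding tempered_def by blast
  have P: "u (P n) = (LINT x|lborel. glued x * P n x)" for n
  proof (induction n)
    case 0
    show ?case
    proof (rule glued_annulus[OF Pt, of 0])
      fix x :: "real^3" assume "x \<notin> annulus 0"
      then have "\<psi> 0 ((4 / 2 ^ 0) *\<^sub>R x) = 0" by (intro zero) (simp add: annulus_def)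
      then show "P 0 x = 0" by (simp add: P_def)
    qed
  next
    case (Suc n)
    define d where "d x = P (Suc n) x - P n x" for x
    have ds: "d \<in> schwartz" unfolding d_def[abs_def] by (intro schwartz_diff Ps)
    have "test d"
    proof -
      obtain R R' where "\<And>x. norm x > R \<Longrightarrow> P n x = 0" "\<And>x. norm x > R' \<Longrightarrow> P (Suc n) x = 0"
        using Pt unfolding test_def by metis
      then have "\<forall>x. norm x > max R R' \<longrightarrow> d x = 0" by (simp add: d_def)
      then show ?thesis using ds unfolding test_def schwartz_def by blast
    qed
    then have "u d = (LINT x|lborel. glued x * d x)"
    proof (rule glued_annulus[of _ "Suc n"])
      fix x :: "real^3" assume x: "x \<notin> annulus (Suc n)"
      \<comment> \<open>The cutoff of index n is 1 up to radius 2^n and 0 beyond 2 * 2^n, the next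
        one is 1 up to 2 * 2^n and 0 beyond 4 * 2^n. They can differ only for 2^n < |x| \<le> 4 *
        2^n, while annulus n+1 reaches from 2^n/4 to 8 * 2^n.\<close>
      have "\<psi> 0 ((4 / 2 ^ Suc n) *\<^sub>R x) = \<psi> 0 ((4 / 2 ^ n) *\<^sub>R x)"
      proof (cases "norm x \<le> 2 ^ n")
        case True
        moreover have "norm x \<le> 2 * 2 ^ n" using True zero_le_power[of "2 :: real" n] by linarith
        ultimately show ?thesis using cutoff_0_eq_1[of "(4 / 2 ^ Suc n) *\<^sub>R x"] cutoff_0_eq_1[of "(4 / 2 ^ n) *\<^sub>R x"]
          by (simp add: field_simps)
      next
        case False
        then have "4 * 2 ^ Suc n \<le> norm x" using x by (auto simp: annulus_def)
        then have "4 * 2 ^ n < norm x" "2 * 2 ^ n < norm x"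
          using zero_less_power[of "2 :: real" n] unfolding power_Suc by linarith+
        then show ?thesis using zero[of "(4 / 2 ^ Suc n) *\<^sub>R x"] zero[of "(4 / 2 ^ n) *\<^sub>R x"]
          by (simp add: field_simps)
      qed
      then show "d x = 0" by (simp add: d_def P_def)
    qed
    moreover have "P (Suc n) = (\<lambda>x. P n x + d x)" by (simp add: d_def fun_eq_iff)
    ultimately show ?case
      using add[OF Ps[of n] ds] int[OF Ps[of n]] int[OF ds] Suc.IH by (simp add: distrib_left)
  qed
  have lim0: "(\<lambda>n. 4 / 2 ^ n :: real) \<longlonglongrightarrow> 0"
    by (rule LIMSEQ_divide_realpow_zero) simp
  have lim1: "(\<lambda>n. u (P n)) \<longlonglongrightarrow> u \<phi>"
  proof -
    obtain C N where CN: "\<And>\<phi>. \<phi> \<in> schwartz \<Longrightarrow> norm (u \<phi>) \<le> C * schwartz_seminorm N \<phi>"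
      using tempered unfolding tempered_def by blast
    have n4: "norm x < 4 \<Longrightarrow> \<psi> 0 x = 1" for x by (rule cutoff_0_eq_1) simp
    obtain D where D: "\<And>c. 0 < c \<Longrightarrow> c \<le> 4 \<Longrightarrow> schwartz_seminorm N (\<lambda>x. (1 - \<psi> 0 (c *\<^sub>R x)) * \<phi> x) \<le> D * c"
      using cutoff_tail_bound[OF \<phi> cutoff n4] by blast
    have "norm (u (P n) - u \<phi>) \<le> \<bar>C\<bar> * D * (4 / 2 ^ n)" for n
    proof -
      let ?e = "\<lambda>x. \<phi> x - P n x"
      have es: "?e \<in> schwartz" by (intro schwartz_diff \<phi> Ps)
      have "u \<phi> = u (P n) + u ?e" using add[OF Ps es, of n] by simp
      then have "norm (u (P n) - u \<phi>) = norm (u ?e)" by simp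
      also have "\<dots> \<le> C * schwartz_seminorm N ?e" by (rule CN[OF es])
      \<comment> \<open>Temperedness gives \<open>C\<close> without a sign; the absolute value is
        needed for monotonicity in the seminorm bound that follows.\<close>
      also have "\<dots> \<le> \<bar>C\<bar> * schwartz_seminorm N ?e"
        unfolding schwartz_seminorm_def using es
        by (intro mult_right_mono sum_nonneg) (auto simp: schwartz_def intro!: cSUP_upper2[of _ _ 0])
      also have "?e = (\<lambda>x. (1 - \<psi> 0 ((4 / 2 ^ n) *\<^sub>R x)) * \<phi> x)"
        by (simp add: P_def left_diff_distrib)
      also have "schwartz_seminorm N \<dots> \<le> D * (4 / 2 ^ n)"
        by (rule D) (auto simp: field_simps)
      finally show ?thesis by (simp add: mult_left_mono mult.assoc)
    qed
    then have "(\<lambda>n. u (P n) - u \<phi>) \<longlonglongrightarrow> 0"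
      by (intro Lim_null_comparison[OF always_eventually tendsto_mult_right_zero[OF lim0]]) blast
    then show ?thesis by (simp add: LIM_zero_iff)
  qed
  obtain B where B: "\<And>x. norm (\<psi> 0 x) \<le> B"
      using test_weighted_bounded[OF cutoff[of 0], of 0] by (auto simp: bdd_above_def)
  have "(\<lambda>n. LINT x|lborel. glued x * P n x) \<longlonglongrightarrow> (LINT x|lborel. glued x * \<phi> x)"
  proof (rule integral_dominated_convergence)
    show "integrable lborel (\<lambda>x. B * norm (glued x * \<phi> x))" using int[OF \<phi>] by simp
    show "(\<lambda>x. glued x * \<phi> x) \<in> borel_measurable lborel" "(\<lambda>x. glued x * P n x) \<in> borel_measurable lborel" for n
      using int[OF \<phi>] int[OF Ps] by (auto dest: borel_measurable_integrable)
    show "AE x in lborel. norm (glued x * P n x) \<le> B * norm (glued x * \<phi> x)" for n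
      using mult_right_mono[OF B, of "norm (glued x * \<phi> x)" for x]
      by (intro AE_I2) (simp add: P_def norm_mult mult_ac)
    show "AE x in lborel. (\<lambda>n. glued x * P n x) \<longlonglongrightarrow> glued x * \<phi> x"
    proof (rule AE_I2)
      fix x :: "real^3"
      have "isCont (\<psi> 0) 0"
        using smooth_continuous[OF testD[OF cutoff[of 0]]] by (simp add: continuous_on_eq_continuous_at)
      moreover have "(\<lambda>n. (4 / 2 ^ n) *\<^sub>R x) \<longlonglongrightarrow> 0 *\<^sub>R x"
        by (rule tendsto_scaleR[OF lim0 tendsto_const])
      ultimately have "(\<lambda>n. \<psi> 0 ((4 / 2 ^ n) *\<^sub>R x)) \<longlonglongrightarrow> \<psi> 0 0"
        by (intro isCont_tendsto_compose[of 0 "\<psi> 0"]) simp_all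
      then have "(\<lambda>n. \<psi> 0 ((4 / 2 ^ n) *\<^sub>R x)) \<longlonglongrightarrow> 1" by (simp add: cutoff_0_eq_1)
      then have "(\<lambda>n. glued x * (\<psi> 0 ((4 / 2 ^ n) *\<^sub>R x) * \<phi> x)) \<longlonglongrightarrow> glued x * (1 * \<phi> x)"
        by (intro tendsto_mult tendsto_const)
      then show "(\<lambda>n. glued x * P n x) \<longlonglongrightarrow> glued x * \<phi> x" by (simp add: P_def)
    qed
  qed
  with lim1 show "u \<phi> = (LINT x|lborel. glued x * \<phi> x)"
    unfolding P by (rule LIMSEQ_unique)
qed

end

section \<open>The weighted embedding\<close>


text \<open>Moving the normalising constant into the density lets the results on \<open>ft\<close>
  apply verbatim; as the constant is at most 1, moments do not increase.\<close>

lemma ift_eq_ft: "ift g = ft (\<lambda>\<xi>. of_real ((2 * pi) powr (-3/2)) * g \<xi>)"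
proof
  fix x
  have "cis (x \<bullet> \<xi>) * (of_real ((2 * pi) powr (-3/2)) * g \<xi>) = of_real ((2 * pi) powr (-3/2)) * (cis (x \<bullet> \<xi>) * g \<xi>)" for \<xi>
    by (rule mult.left_commute)
  then show "ift g x = ft (\<lambda>\<xi>. of_real ((2 * pi) powr (-3/2)) * g \<xi>) x"
    unfolding ift_def ft_def scaleR_conv_of_real by (simp only: integral_mult_right_zero)
qed

lemma fourier_constant_le_1: "(2 * pi) powr (-3/2) \<le> 1"
proof -
  have "(2 * pi) powr (-3/2) \<le> (2 * pi) powr 0"
    using pi_gt3 by (intro powr_mono) auto
  then show ?thesis by simp
qed

lemma finite_moment_ift_density:
  assumes "finite_moment k g"
  shows "finite_moment k (\<lambda>\<xi>. of_real ((2 * pi) powr (-3/2)) * g \<xi>)"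
  by (rule finite_moment_mult[of 0]) (use assms fourier_constant_le_1 in auto)

lemma C_k_ift: "finite_moment k g \<Longrightarrow> C_k k (ift g)"
  unfolding ift_eq_ft by (intro C_k_ft finite_moment_ift_density)

lemma norm_mderiv_ift_le:
  assumes "finite_moment m g" "order_mi \<alpha> \<le> m"
  shows "norm (mderiv \<alpha> (ift g) x) \<le> (LINT \<xi>|lborel. (1 + norm \<xi>) ^ m * norm (g \<xi>))"
proof -
  let ?h = "\<lambda>\<xi>. of_real ((2 * pi) powr (-3/2)) * g \<xi>"
  have h: "finite_moment m ?h" using assms(1) by (rule finite_moment_ift_density)
  have "norm (mderiv \<alpha> (ift g) x) \<le> (LINT \<xi>|lborel. (1 + norm \<xi>) ^ m * norm (?h \<xi>))"
    unfolding ift_eq_ft using h assms(2) by (rule norm_mderiv_ft_le)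
  also have "\<dots> \<le> (LINT \<xi>|lborel. (1 + norm \<xi>) ^ m * norm (g \<xi>))"
  proof (rule integral_mono)
    fix \<xi> :: "real^3"
    have "norm (?h \<xi>) \<le> norm (g \<xi>)"
      using mult_right_mono[OF fourier_constant_le_1, of "norm (g \<xi>)"] by (simp add: norm_mult)
    then show "(1 + norm \<xi>) ^ m * norm (?h \<xi>) \<le> (1 + norm \<xi>) ^ m * norm (g \<xi>)"
      by (intro mult_left_mono) auto
  qed (rule h[unfolded finite_moment_def, THEN conjunct2] assms(1)[unfolded finite_moment_def, THEN conjunct2])+
  finally show ?thesis .
qed

text \<open>Both inverse transforms are continuous and pair with every test function as
  \<open>T\<close> does.\<close>

lemma ift_unique:
  assumes r: "represents g (dist_fourier T)" "represents g' (dist_fourier T)"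
    and i: "integrable lborel g" "integrable lborel g'"
    and b: "test b" "(LINT x|lborel. b x) \<noteq> 0"
  shows "ift g = ift g'"
proof
  fix a
  have c: "continuous_on UNIV (ift f)" if "integrable lborel f" for f
    unfolding ift_def using continuous_ft[OF that] by (intro continuous_intros)
  have "(\<lambda>x. ift g x - ift g' x) a = 0"
  proof (rule continuous_eq_0_if_test_integrals_0[OF _ open_UNIV UNIV_I b])
    show "continuous_on UNIV (\<lambda>x. ift g x - ift g' x)"
      using c i by (intro continuous_intros) auto
    fix \<phi> assume \<phi>: "test \<phi>"
    have int: "integrable lborel (\<lambda>x. ift f x * \<phi> x)" if "integrable lborel f" for f
    proof -
      obtain R where "\<And>x. norm x > R \<Longrightarrow> \<phi> x = 0" using \<phi> by (auto simp: test_def)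
      then show ?thesis
        using smooth_continuous[OF testD[OF \<phi>]] c[OF that]
        by (intro integrable_compact_support[of _ R] continuous_intros) auto
    qed
    have "(LINT x|lborel. ift g x * \<phi> x) = (LINT x|lborel. ift g' x * \<phi> x)"
      using represents_fourier_test[OF r(1) i(1) \<phi>] represents_fourier_test[OF r(2) i(2) \<phi>] by simp
    then show "(LINT x|lborel. (ift g x - ift g' x) * \<phi> x) = 0"
      using int[OF i(1)] int[OF i(2)] by (simp add: left_diff_distrib)
  qed
  then show "ift g a = ift g' a" by simp
qed

text \<open>The infimum in \<open>Hs_norm_sq\<close> is approached by some density
  \<open>g'\<close>, possibly different from \<open>g\<close>. The moment estimate is applied to
  \<open>g'\<close> and transferred to \<open>g\<close> because their inverse transforms coincide.
  The bump \<open>b\<close> enters through this uniqueness.\<close>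

lemma ift_bound_of_Hs_norm:
  assumes s: "s > 3/2 + real m" and b: "test b" "(LINT x|lborel. b x) \<noteq> 0"
  obtains C where "C \<ge> 0"
    "\<And>T g. represents g (dist_fourier T) \<Longrightarrow>
      (\<integral>\<^sup>+ \<xi>. ennreal ((1 + (norm \<xi>)\<^sup>2) powr s * (norm (g \<xi>))\<^sup>2) \<partial>lborel) < \<infinity> \<Longrightarrow>
      finite_moment m g \<and>
      (\<forall>\<alpha> x. order_mi \<alpha> \<le> m \<longrightarrow> norm (mderiv \<alpha> (ift g) x) \<le> C * sqrt (enn2real (Hs_norm_sq s T)))"
proof -
  let ?I = "\<lambda>g. \<integral>\<^sup>+ \<xi>. ennreal ((1 + (norm \<xi>)\<^sup>2) powr s * (norm (g \<xi> :: complex))\<^sup>2) \<partial>(lborel :: (real^3) measure)"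
  obtain C where C0: "C \<ge> 0"
    and C: "\<And>g L. g \<in> borel_measurable borel \<Longrightarrow> L > 0 \<Longrightarrow> ?I g \<le> ennreal (L\<^sup>2) \<Longrightarrow>
      finite_moment m g \<and> (LINT \<xi>|lborel. (1 + norm (\<xi>::real^3)) ^ m * norm (g \<xi>)) \<le> C * L"
    using moment_bound[OF s] by blast
  show ?thesis
  proof (rule that[OF C0])
    fix T g assume rep: "represents g (dist_fourier T)" and fin: "?I g < \<infinity>"
    have meas: "f \<in> borel_measurable borel" if "represents f (dist_fourier T)" for f
      using that by (simp add: represents_def)
    obtain i where i: "?I g = ennreal i" "i \<ge> 0" using fin by (cases "?I g") auto
    \<comment> \<open>The moment estimate asks for \<open>L > 0\<close>, so the square root is
      increased by 1 to cover \<open>i = 0\<close>; only finiteness of the moment is extracted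
      here.\<close>
    have "i \<le> (sqrt i + 1)\<^sup>2" using i(2) by (simp add: power2_sum)
    then have fm: "finite_moment m g"
      using C[OF meas[OF rep], of "sqrt i + 1"] i by (simp add: ennreal_leI add_nonneg_pos)
    define n where "n = enn2real (Hs_norm_sq s T)"
    have "Hs_norm_sq s T \<le> ?I g"
      unfolding Hs_norm_sq_def using rep by (intro INF_lower) simp
    then have n: "Hs_norm_sq s T = ennreal n" "n \<ge> 0"
      using fin by (auto simp: n_def less_top dest: le_less_trans)
    have "norm (mderiv \<alpha> (ift g) x) \<le> C * sqrt n" if \<alpha>: "order_mi \<alpha> \<le> m" for \<alpha> x
    proof (rule field_le_epsilon)
      fix e' :: real assume e': "e' > 0"
      \<comment> \<open>Dividing by \<open>C + 1\<close> allows for \<open>C = 0\<close> and keeps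
        the error \<open>C * e\<close> below \<open>e'\<close>.\<close>
      define e where "e = e' / (C + 1)"
      have e: "e > 0" using e' C0 by (simp add: e_def)
      have Ce: "C * e \<le> e'" using e' C0 by (simp add: e_def field_simps)
      define L where "L = sqrt n + e"
      have L: "L > 0" using n(2) e by (simp add: L_def add_nonneg_pos)
      have "(sqrt n)\<^sup>2 < L\<^sup>2" using n(2) e by (intro power_strict_mono) (auto simp: L_def)
      then have "Hs_norm_sq s T < ennreal (L\<^sup>2)" using n by (simp add: ennreal_less_iff)
      then obtain g' where g': "represents g' (dist_fourier T)" "?I g' < ennreal (L\<^sup>2)"
        unfolding Hs_norm_sq_def INF_less_iff by blast
      then have *: "finite_moment m g'" "(LINT \<xi>|lborel. (1 + norm \<xi>) ^ m * norm (g' \<xi>)) \<le> C * L"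
        using C[OF meas[OF g'(1)] L] by auto
      have "ift g = ift g'"
        by (rule ift_unique[OF rep g'(1) finite_moment_integrable[OF fm] finite_moment_integrable[OF *(1)] b])
      then have "norm (mderiv \<alpha> (ift g) x) \<le> C * L"
        using norm_mderiv_ift_le[OF *(1) \<alpha>, of x] *(2) by simp
      also have "\<dots> \<le> C * sqrt n + e'" using Ce by (simp add: L_def distrib_left)
      finally show "norm (mderiv \<alpha> (ift g) x) \<le> C * sqrt n + e'" .
    qed
    with fm show "finite_moment m g \<and>
      (\<forall>\<alpha> x. order_mi \<alpha> \<le> m \<longrightarrow> norm (mderiv \<alpha> (ift g) x) \<le> C * sqrt (enn2real (Hs_norm_sq s T)))"
      by (simp add: n_def)
  qed
qed

section \<open>Properties of the given cutoffs\<close>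

lemma mem_supp: "f x \<noteq> 0 \<Longrightarrow> x \<in> supp f"
  unfolding supp_def by (rule subsetD[OF closure_subset]) simp

lemma dyadic_cutoffs_test:
  assumes "dyadic_cutoffs \<psi>" shows "test (\<psi> j)"
proof -
  have "compact (supp (\<psi> j))" "smooth (\<psi> j)" using assms by (auto simp: dyadic_cutoffs_def)
  then have "bounded (supp (\<psi> j))" by (intro compact_imp_bounded)
  then obtain R where R: "\<forall>x\<in>supp (\<psi> j). norm x \<le> R"
    unfolding bounded_iff by blast
  have "\<psi> j x = 0" if "norm x > R" for x
  proof (rule ccontr)
    assume "\<psi> j x \<noteq> 0"
    then have "x \<in> supp (\<psi> j)" by (rule mem_supp)
    with R that show False by auto
  qed
  with \<open>smooth (\<psi> j)\<close> show ?thesis unfolding test_def by blast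
qed

lemma dyadic_cutoffs_annulus:
  assumes "dyadic_cutoffs \<psi>" "x \<in> annulus j" shows "\<psi> j x = 1"
  using assms annulus_subset_K unfolding dyadic_cutoffs_def by blast

lemma dyadic_cutoffs_0_zero:
  assumes "dyadic_cutoffs \<psi>" "norm x > 8" shows "\<psi> 0 x = 0"
proof (rule ccontr)
  assume "\<psi> 0 x \<noteq> 0"
  then have "x \<in> supp (\<psi> 0)" by (rule mem_supp)
  then have "norm x \<le> 8" using assms(1) unfolding dyadic_cutoffs_def by blast
  with assms(2) show False by simp
qed

theorem theorem8p15:
  fixes m :: nat and \<beta> \<delta> s :: real and \<psi> :: "nat \<Rightarrow> real^3 \<Rightarrow> complex"
  assumes "dyadic_cutoffs \<psi>"
    and "s > 3/2 + real m"
    and "\<delta> + 3/2 \<ge> \<beta>"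
  shows "\<exists>C::real. \<forall>u \<in> H_weighted \<psi> s \<delta>.
           \<exists>u' \<in> C_weighted m \<beta>. represents u' u \<and>
             C_weighted_norm m \<beta> u' \<le> C * H_weighted_norm \<psi> s \<delta> u"
proof -
  have one: "\<psi> 0 x = 1" if "norm x < 4" for x
    using dyadic_cutoffs_annulus[OF assms(1), of x 0] that by (simp add: annulus_def)
  obtain C0 where C0: "C0 \<ge> 0" and bound:
    "\<And>T g. represents g (dist_fourier T) \<Longrightarrow>
      (\<integral>\<^sup>+ \<xi>. ennreal ((1 + (norm \<xi>)\<^sup>2) powr s * (norm (g \<xi>))\<^sup>2) \<partial>lborel) < \<infinity> \<Longrightarrow>
      finite_moment m g \<and>
      (\<forall>\<alpha> x. order_mi \<alpha> \<le> m \<longrightarrow> norm (mderiv \<alpha> (ift g) x) \<le> C0 * sqrt (enn2real (Hs_norm_sq s T)))"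
    using ift_bound_of_Hs_norm[OF assms(2) test_norm_square_integral[OF dyadic_cutoffs_test[OF assms(1), of 0] one]]
    by blast
  \<comment> \<open>The first factor comes from comparing the weight with 2^j for all exponents at
    once, the second from the unweighted bound at scale 1. Summing over the derivatives multiplies
    \<open>A\<close> by the number of multi-indices.\<close>
  define A where "A = 8 powr (\<bar>\<beta>\<bar> + real m) * C0"
  have "\<exists>u' \<in> C_weighted m \<beta>. represents u' u \<and>
      C_weighted_norm m \<beta> u' \<le> (real (card {\<alpha>. order_mi \<alpha> \<le> m}) * A) * H_weighted_norm \<psi> s \<delta> u"
    if u: "u \<in> H_weighted \<psi> s \<delta>" for u
  proof -
    let ?T = "\<lambda>j. dist_dilate (2 ^ j) (dist_mult (\<psi> j) u)"
    let ?N = "\<lambda>j. Hs_norm_sq s (?T j)"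
    let ?t = "\<lambda>j. 2 powr ((3/2 + \<delta>) * 2 * real j)"
    have fin: "H_weighted_norm_sq \<psi> s \<delta> u < \<infinity>" using u by (simp add: H_weighted_def)
    have le: "ennreal (?t j) * ?N j \<le> H_weighted_norm_sq \<psi> s \<delta> u" for j
      unfolding H_weighted_norm_sq_def
      using sum_le_suminf[of "\<lambda>j. ennreal (?t j) * ?N j" "{j}"] by simp
    have finj: "ennreal (?t j) * ?N j < \<infinity>" for j using le[of j] fin by (rule le_less_trans)
    \<comment> \<open>The dyadic weight is a positive real, so an infinite norm of one piece would
      make its term in the series infinite.\<close>
    have "?N j < \<infinity>" for j
      using finj[of j] by (cases "?N j = 0") (auto simp: ennreal_mult_less_top)
    then have "\<forall>j. \<exists>g. represents g (dist_fourier (?T j)) \<and>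
        (\<integral>\<^sup>+ \<xi>. ennreal ((1 + (norm \<xi>)\<^sup>2) powr s * (norm (g \<xi>))\<^sup>2) \<partial>lborel) < \<infinity>"
      unfolding Hs_norm_sq_def INF_less_iff by blast
    from choice[OF this] obtain g where g: "\<And>j. represents (g j) (dist_fourier (?T j))"
      "\<And>j. (\<integral>\<^sup>+ \<xi>. ennreal ((1 + (norm \<xi>)\<^sup>2) powr s * (norm (g j \<xi>))\<^sup>2) \<partial>lborel) < \<infinity>"
      by blast
    have fm: "finite_moment m (g j)" for j using bound[OF g] by blast
    have gb: "norm (mderiv \<alpha> (ift (g j)) x) \<le> C0 * sqrt (enn2real (?N j))" if "order_mi \<alpha> \<le> m" for \<alpha> j x
      using bound[OF g] that by blast
    \<comment> \<open>Dilating back by 2^j returns from the unit scale, where the H^s norm is taken,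
      to the annulus.\<close>
    define w where "w j x = ift (g j) (x /\<^sub>R 2 ^ j)" for j x
    have wC: "C_k m (w j)" for j
      using C_k_affine[OF C_k_ift[OF fm[of j]], of "inverse (2 ^ j)" 0] by (simp add: w_def[abs_def])
    interpret dyadic_pieces \<psi> u w
    proof
      show "tempered u" using u by (simp add: H_weighted_def)
      show "test (\<psi> j)" for j using assms(1) by (rule dyadic_cutoffs_test)
      show "\<psi> j x = 1" if "x \<in> annulus j" for x j using assms(1) that by (rule dyadic_cutoffs_annulus)
      show "\<psi> 0 x = 0" if "norm x > 8" for x using assms(1) that by (rule dyadic_cutoffs_0_zero)
      show "continuous_on UNIV (w j)" for j using wC by (rule C_k_imp_continuous)
      show "u (\<lambda>x. \<psi> j x * \<phi> x) = (LINT x|lborel. w j x * \<phi> x)" if "test \<phi>" for \<phi> j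
        unfolding w_def by (rule represents_dilate_test[OF g(1) finite_moment_integrable[OF fm] that]) simp
    qed
    have gC: "C_k m glued"
    proof (rule C_k_local)
      fix x
      obtain j where "x \<in> annulus j" using annulus_cover by blast
      then show "\<exists>U h. open U \<and> x \<in> U \<and> C_k m h \<and> (\<forall>y\<in>U. glued y = h y)"
        using open_annulus wC glued_eq by blast
    qed
    have main: "(1 + norm x) powr (\<beta> + real (order_mi \<alpha>)) * norm (mderiv \<alpha> glued x) \<le> A * H_weighted_norm \<psi> s \<delta> u"
      if \<alpha>: "order_mi \<alpha> \<le> m" for \<alpha> x
    proof -
      obtain j where j: "x \<in> annulus j" using annulus_cover by blast
      define k where "k = order_mi \<alpha>"
      define q :: real where "q = 2 ^ j"
      have q: "1 \<le> q" by (simp add: q_def)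
      define h where "h = enn2real (?N j)"
      have h0: "0 \<le> h" by (simp add: h_def)
      have "mderiv \<alpha> glued x = mderiv \<alpha> (w j) x"
        by (rule mderiv_cong_open[OF open_annulus glued_eq j])
      also have "\<dots> = inverse q ^ k *\<^sub>R mderiv \<alpha> (ift (g j)) (inverse q *\<^sub>R x)"
        using mderiv_scale[OF C_k_mono[OF C_k_ift[OF fm[of j]] \<alpha>], of "inverse q"]
        by (simp add: w_def[abs_def] q_def k_def)
      finally have n: "norm (mderiv \<alpha> glued x) \<le> inverse q ^ k * (C0 * sqrt h)"
        using gb[OF \<alpha>, of j "inverse q *\<^sub>R x"] q by (simp add: h_def mult_left_mono)
      have "\<bar>\<beta> + real k\<bar> \<le> \<bar>\<beta>\<bar> + real m" using \<alpha> by (simp add: k_def)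
      from weight_le_on_annulus[OF j this]
      have "(1 + norm x) powr (\<beta> + real k) * norm (mderiv \<alpha> glued x) \<le>
          (8 powr (\<bar>\<beta>\<bar> + real m) * q powr (\<beta> + real k)) * (inverse q ^ k * (C0 * sqrt h))"
        unfolding q_def[symmetric] using n by (intro mult_mono) auto
      also have "\<dots> = A * ((q powr (\<beta> + real k) * inverse q ^ k) * sqrt h)"
        by (simp add: A_def mult_ac)
      \<comment> \<open>The extra weight of order |\<alpha>| exactly compensates the powers of
        2^(-j) from the chain rule; hence the weight in the norm grows with the order of the
        derivative.\<close>
      also have "q powr (\<beta> + real k) * inverse q ^ k = q powr \<beta>"
        using q by (simp add: powr_add powr_realpow power_inverse field_simps)
      \<comment> \<open>The condition relating \<beta> and \<delta> enters here, together with 2^j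
        \<ge> 1.\<close>
      also have "A * (q powr \<beta> * sqrt h) \<le> A * (q powr (3/2 + \<delta>) * sqrt h)"
        using q assms(3) C0 h0 by (intro mult_left_mono mult_right_mono powr_mono) (auto simp: A_def)
      also have "q powr (3/2 + \<delta>) * sqrt h = sqrt (?t j * h)"
      proof -
        have "q powr (3/2 + \<delta>) = 2 powr ((3/2 + \<delta>) * real j)"
          unfolding q_def by (simp add: powr_realpow[symmetric] powr_powr mult.commute)
        moreover have "?t j = (2 powr ((3/2 + \<delta>) * real j))\<^sup>2"
          by (simp add: power2_eq_square powr_add[symmetric] algebra_simps)
        ultimately show ?thesis by (simp add: real_sqrt_mult)
      qed
      \<comment> \<open>A single term of the series of nonnegative terms is at most its sum.\<close>
      also have "\<dots> \<le> H_weighted_norm \<psi> s \<delta> u"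
      proof -
        have "?t j * h = enn2real (ennreal (?t j) * ?N j)"
          by (simp add: h_def enn2real_mult)
        also have "\<dots> \<le> enn2real (H_weighted_norm_sq \<psi> s \<delta> u)"
          using le fin by (intro enn2real_mono) auto
        finally show ?thesis by (simp add: H_weighted_norm_def)
      qed
      finally show ?thesis
        using C0 by (simp add: k_def A_def mult_left_mono)
    qed
    have "glued \<in> C_weighted m \<beta>"
      using gC main by (auto simp: C_weighted_def intro!: bdd_aboveI2)
    moreover have "represents glued u"
    proof (rule represents_glued)
      show "continuous_on UNIV glued" using gC by (rule C_k_imp_continuous)
      fix x :: "real^3"
      have "order_mi 0 = 0" "mderiv 0 glued = glued" by (simp_all add: order_mi_def mderiv_def)
      then have "(1 + norm x) powr \<beta> * norm (glued x) \<le> A * H_weighted_norm \<psi> s \<delta> u"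
        using main[of 0 x] by simp
      moreover have "(1 + norm x) powr \<beta> > 0" unfolding powr_gt_zero using norm_ge_zero[of x] by linarith
      \<comment> \<open>The zeroth-order part of the weighted bound is the polynomial growth
        condition with exponent -\<beta>.\<close>
      ultimately show "norm (glued x) \<le> A * H_weighted_norm \<psi> s \<delta> u * (1 + norm x) powr (- \<beta>)"
        by (simp add: powr_minus field_simps)
    qed
    moreover have "C_weighted_norm m \<beta> glued \<le> (\<Sum>\<alpha> | order_mi \<alpha> \<le> m. A * H_weighted_norm \<psi> s \<delta> u)"
      unfolding C_weighted_norm_def using main by (intro sum_mono cSUP_least) auto
    ultimately show ?thesis by (intro bexI[of _ glued]) (auto simp: mult.assoc)
  qed
  then show ?thesis by blast
qed

end
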